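(* Let $\mathfrak g$ be an affine Kac–Moody algebra with set of real roots $\Phi$, and let $\mathfrak g'$ be a subalgebra of $\mathfrak g$. Then the following are equivalent: (1) there exists a closed subroot system $\Psi$ of $\Phi$ such that $\mathfrak g'=\mathfrak g(\Psi)$; (2) there exists a $\pi$-system $\Sigma$ of $\Phi$ such that $\mathfrak g'=\mathfrak g(\Sigma)$; (3) there exists a symmetric subset $\Sigma_s$ of $\Phi$ such that $\mathfrak g'=\mathfrak g(\Sigma_s)$.
   Context: $\mathfrak g$ is the affine Kac–Moody algebra over $\mathbb C$ attached to an indecomposable affine Cartan matrix (untwisted or twisted), with Cartan subalgebra $\mathfrak h$, root spaces $\mathfrak g_\alpha$, set of roots $\Delta(\mathfrak g)$ (nonzero), and set of real roots $\Phi\subset\Delta(\mathfrak g)$; $(\cdot,\cdot)$ is a standard symmetric non-degenerate invariant form on $\mathfrak h^*$, $\langle\beta,\alpha^\vee\rangle=2(\beta,\alpha)/(\alpha,\alpha)$ and $\mathbf s_\alpha(\beta)=\beta-\langle\beta,\alpha^\vee\rangle\alpha$ for $\alpha\in\Phi$. A non-empty subset $\Psi\subseteq\Phi$ is a closed subroot system if $\mathbf s_\alpha(\beta)\in\Psi$ for all $\alpha,\beta\in\Psi$, and $\alpha,\beta\in\Psi$ with $\alpha+\beta\in\Phi$ imply $\alpha+\beta\in\Psi$. $\mathfrak g(\Psi)$ is the Lie subalgebra of $\mathfrak g$ generated by the $\mathfrak g_\alpha$, $\alpha\in\Psi$. A $\pi$-system is a non-empty finite subset $\Sigma\subset\Phi$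 such that $\alpha-\beta\notin\Delta(\mathfrak g)$ for all $\alpha,\beta\in\Sigma$ (linear independence is not required); $\mathfrak g(\Sigma)$ is the Lie subalgebra generated by $\mathfrak g_\alpha$, $\alpha\in\Sigma\cup(-\Sigma)$. A symmetric subset is a non-empty $\Sigma_s\subseteq\Phi$ with $\Sigma_s=-\Sigma_s$; $\mathfrak g(\Sigma_s)$ is the Lie subalgebra generated by $\mathfrak g_\alpha$, $\alpha\in\Sigma_s$. *)

theory Defs
  imports "HOL-Analysis.Analysis" "HOL-Library.Function_Algebras"
begin

section \<open>Cartan matrices of affine type\<close>

definition generalized_cartan_matrix :: "int ^ 'n ^ 'n \<Rightarrow> bool" where
  "generalized_cartan_matrix A \<longleftrightarrow>
     (\<forall>i. A $ i $ i = 2) \<and>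
     (\<forall>i j. i \<noteq> j \<longrightarrow> A $ i $ j \<le> 0) \<and>
     (\<forall>i j. A $ i $ j = 0 \<longrightarrow> A $ j $ i = 0)"

definition indecomposable_matrix :: "int ^ 'n ^ 'n \<Rightarrow> bool" where
  "indecomposable_matrix A \<longleftrightarrow>
     (\<forall>S. S \<noteq> {} \<and> S \<noteq> UNIV \<longrightarrow>
        (\<exists>i\<in>S. \<exists>j\<in>-S. A $ i $ j \<noteq> 0 \<or> A $ j $ i \<noteq> 0))"

definition real_matrix :: "int ^ 'n ^ 'n \<Rightarrow> real ^ 'n ^ 'n" where
  "real_matrix A = map_matrix real_of_int A"

text \<open>
  The (Aff) case of the trichotomy finite / affine / indefinite for indecomposable
  generalized Cartan matrices (V. Kac, Infinite dimensional Lie algebras, Theorem 4.3).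
  It comprises both the untwisted and the twisted types.
\<close>

definition affine_cartan_matrix :: "int ^ 'n ^ 'n \<Rightarrow> bool" where
  "affine_cartan_matrix A \<longleftrightarrow>
     generalized_cartan_matrix A \<and> indecomposable_matrix A \<and>
     rank (real_matrix A) + 1 = CARD('n) \<and>
     (\<exists>u. (\<forall>i. u $ i > 0) \<and> real_matrix A *v u = 0) \<and>
     (\<forall>v. (\<forall>i. (real_matrix A *v v) $ i \<ge> 0) \<longrightarrow> real_matrix A *v v = 0)"


section \<open>Complex Lie algebras\<close>

locale lie_algebra = vector_space scl
  for scl :: "complex \<Rightarrow> 'g::ab_group_add \<Rightarrow> 'g" +
  fixes br :: "'g \<Rightarrow> 'g \<Rightarrow> 'g"
  assumes linear_right: "Vector_Spaces.linear scl scl (\<lambda>y. br x y)"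
    and linear_left: "Vector_Spaces.linear scl scl (\<lambda>x. br x y)"
    and alternating: "br x x = 0"
    and jacobi: "br x (br y z) + br y (br z x) + br z (br x y) = 0"

definition lie_subalgebra ::
    "(complex \<Rightarrow> 'g::ab_group_add \<Rightarrow> 'g) \<Rightarrow> ('g \<Rightarrow> 'g \<Rightarrow> 'g) \<Rightarrow> 'g set \<Rightarrow> bool" where
  "lie_subalgebra scl br L \<longleftrightarrow>
     module.subspace scl L \<and> (\<forall>x\<in>L. \<forall>y\<in>L. br x y \<in> L)"

definition lie_ideal ::
    "(complex \<Rightarrow> 'g::ab_group_add \<Rightarrow> 'g) \<Rightarrow> ('g \<Rightarrow> 'g \<Rightarrow> 'g) \<Rightarrow> 'g set \<Rightarrow> bool" where
  "lie_ideal scl br I \<longleftrightarrow>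
     module.subspace scl I \<and> (\<forall>x. \<forall>y\<in>I. br x y \<in> I)"


section \<open>Kac-Moody algebras\<close>

text \<open>
  The underlying set of the Lie algebra is the whole type \<open>'g\<close>, and \<open>'n\<close> indexes the
  rows and columns of the Cartan matrix. A linear functional on the Cartan subalgebra
  is represented by the function on \<open>'g\<close> that extends it by 0 outside the Cartan
  subalgebra (see \<open>dual_cartan\<close>). This makes equality of functionals equality of
  functions, and the pointwise operations on functions preserve the convention.
\<close>

record ('g, 'n) kac_moody_data =
  scl :: "complex \<Rightarrow> 'g \<Rightarrow> 'g"
  brk :: "'g \<Rightarrow> 'g \<Rightarrow> 'g"
  cartan :: "'g set"
  simple_root :: "'n \<Rightarrow> 'g \<Rightarrow> complex"
  simple_coroot :: "'n \<Rightarrow> 'g"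
  chev_e :: "'n \<Rightarrow> 'g"
  chev_f :: "'n \<Rightarrow> 'g"

definition dual_cartan ::
    "('g::ab_group_add, 'n) kac_moody_data \<Rightarrow> ('g \<Rightarrow> complex) set" where
  "dual_cartan \<gg> =
     {\<phi>. (\<forall>x\<in>cartan \<gg>. \<forall>y\<in>cartan \<gg>. \<phi> (x + y) = \<phi> x + \<phi> y) \<and>
          (\<forall>c. \<forall>x\<in>cartan \<gg>. \<phi> (scl \<gg> c x) = c * \<phi> x) \<and>
          (\<forall>x. x \<notin> cartan \<gg> \<longrightarrow> \<phi> x = 0)}"

text \<open>
  \<open>\<gg>\<close> is the Kac-Moody algebra of \<open>A\<close>, that is, the quotient by the largest ideal
  meeting the Cartan subalgebra trivially of the Lie algebra generated by a realization
  of \<open>A\<close> and elements \<open>e i\<close>, \<open>f i\<close> subject to the relations below. A Lie algebra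
  with such data is this quotient precisely if the relations hold, the data generate it,
  and no nonzero ideal meets the Cartan subalgebra trivially (Kac, Proposition 1.4).
\<close>

locale kac_moody_algebra = lie_algebra "scl \<gg>" "brk \<gg>"
  for A :: "int ^ 'n ^ 'n" and \<gg> :: "('g::ab_group_add, 'n) kac_moody_data" +
  assumes gcm: "generalized_cartan_matrix A"
    \<comment> \<open>realization of the Cartan matrix\<close>
    and cartan_subspace: "subspace (cartan \<gg>)"
    and cartan_dim: "dim (cartan \<gg>) + rank (real_matrix A) = 2 * CARD('n)"
    and coroot_in_cartan: "simple_coroot \<gg> i \<in> cartan \<gg>"
    and root_in_dual: "simple_root \<gg> i \<in> dual_cartan \<gg>"
    and coroots_independent:
      "(\<Sum>i\<in>UNIV. scl \<gg> (c i) (simple_coroot \<gg> i)) = 0 \<Longrightarrow> c i = 0"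
    and roots_independent:
      "(\<And>h. h \<in> cartan \<gg> \<Longrightarrow> (\<Sum>i\<in>UNIV. c i * simple_root \<gg> i h) = 0) \<Longrightarrow> c i = 0"
    and pairing: "simple_root \<gg> j (simple_coroot \<gg> i) = of_int (A $ i $ j)"
    \<comment> \<open>defining relations\<close>
    and rel_ef: "brk \<gg> (chev_e \<gg> i) (chev_f \<gg> j) = (if i = j then simple_coroot \<gg> i else 0)"
    and rel_hh: "h \<in> cartan \<gg> \<Longrightarrow> h' \<in> cartan \<gg> \<Longrightarrow> brk \<gg> h h' = 0"
    and rel_he: "h \<in> cartan \<gg> \<Longrightarrow>
      brk \<gg> h (chev_e \<gg> i) = scl \<gg> (simple_root \<gg> i h) (chev_e \<gg> i)"
    and rel_hf: "h \<in> cartan \<gg> \<Longrightarrow>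
      brk \<gg> h (chev_f \<gg> i) = scl \<gg> (- simple_root \<gg> i h) (chev_f \<gg> i)"
    and generated:
      "lie_subalgebra (scl \<gg>) (brk \<gg>) hull
         (range (chev_e \<gg>) \<union> range (chev_f \<gg>) \<union> cartan \<gg>) = UNIV"
    and no_ideals:
      "lie_ideal (scl \<gg>) (brk \<gg>) I \<Longrightarrow> I \<inter> cartan \<gg> = {0} \<Longrightarrow> I = {0}"

definition root_space ::
    "('g::ab_group_add, 'n) kac_moody_data \<Rightarrow> ('g \<Rightarrow> complex) \<Rightarrow> 'g set" where
  "root_space \<gg> \<alpha> = {x. \<forall>h\<in>cartan \<gg>. brk \<gg> h x = scl \<gg> (\<alpha> h) x}"

definition roots :: "('g::ab_group_add, 'n) kac_moody_data \<Rightarrow> ('g \<Rightarrow> complex) set" where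
  "roots \<gg> = {\<alpha> \<in> dual_cartan \<gg>. \<alpha> \<noteq> 0 \<and> root_space \<gg> \<alpha> \<noteq> {0}}"

definition simple_reflection ::
    "('g::ab_group_add, 'n) kac_moody_data \<Rightarrow> 'n \<Rightarrow> ('g \<Rightarrow> complex) \<Rightarrow> ('g \<Rightarrow> complex)" where
  "simple_reflection \<gg> i \<phi> = (\<lambda>h. \<phi> h - \<phi> (simple_coroot \<gg> i) * simple_root \<gg> i h)"

inductive_set weyl_group ::
    "('g::ab_group_add, 'n) kac_moody_data \<Rightarrow> (('g \<Rightarrow> complex) \<Rightarrow> ('g \<Rightarrow> complex)) set"
  for \<gg> :: "('g::ab_group_add, 'n) kac_moody_data" where
  one: "id \<in> weyl_group \<gg>"
| refl: "w \<in> weyl_group \<gg> \<Longrightarrow> simple_reflection \<gg> i \<circ> w \<in> weyl_group \<gg>"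

definition real_roots :: "('g::ab_group_add, 'n) kac_moody_data \<Rightarrow> ('g \<Rightarrow> complex) set" where
  "real_roots \<gg> = {\<alpha> \<in> roots \<gg>. \<exists>w\<in>weyl_group \<gg>. w \<alpha> \<in> range (simple_root \<gg>)}"


section \<open>Standard invariant forms\<close>

text \<open>
  \<open>standard_form_on_cartan A \<gg> B\<close>: for some decomposition \<open>A = diag(\<epsilon>) M\<close> with \<open>M\<close>
  symmetric and all \<open>\<epsilon> i > 0\<close>, and some complement \<open>C\<close> of the span of the simple coroots
  in the Cartan subalgebra, \<open>B\<close> is the bilinear form determined by
  \<open>B (simple_coroot i) h = simple_root i h * \<epsilon> i\<close> and \<open>B = 0\<close> on \<open>C \<times> C\<close> (Kac, Section 2.1).
\<close>

definition standard_form_on_cartan ::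
    "int ^ 'n ^ 'n \<Rightarrow> ('g::ab_group_add, 'n) kac_moody_data \<Rightarrow>
     ('g \<Rightarrow> 'g \<Rightarrow> complex) \<Rightarrow> bool" where
  "standard_form_on_cartan A \<gg> B \<longleftrightarrow>
     (\<forall>x\<in>cartan \<gg>. \<forall>y\<in>cartan \<gg>. \<forall>z\<in>cartan \<gg>. B (x + y) z = B x z + B y z) \<and>
     (\<forall>c. \<forall>x\<in>cartan \<gg>. \<forall>y\<in>cartan \<gg>. B (scl \<gg> c x) y = c * B x y) \<and>
     (\<forall>x\<in>cartan \<gg>. \<forall>y\<in>cartan \<gg>. B x y = B y x) \<and>
     (\<forall>x\<in>cartan \<gg>. (\<forall>y\<in>cartan \<gg>. B x y = 0) \<longrightarrow> x = 0) \<and>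
     (\<exists>(\<epsilon> :: 'n \<Rightarrow> real) C.
        (\<forall>i. \<epsilon> i > 0) \<and>
        (\<forall>i j. real_of_int (A $ i $ j) / \<epsilon> i = real_of_int (A $ j $ i) / \<epsilon> j) \<and>
        module.subspace (scl \<gg>) C \<and>
        C \<inter> module.span (scl \<gg>) (range (simple_coroot \<gg>)) = {0} \<and>
        {x + y |x y. x \<in> module.span (scl \<gg>) (range (simple_coroot \<gg>)) \<and> y \<in> C} = cartan \<gg> \<and>
        (\<forall>i. \<forall>h\<in>cartan \<gg>. B (simple_coroot \<gg> i) h = simple_root \<gg> i h * of_real (\<epsilon> i)) \<and>
        (\<forall>x\<in>C. \<forall>y\<in>C. B x y = 0))"

text \<open>
  The form on the dual obtained by transport along the isomorphism
  \<open>x \<mapsto> B x\<close> from the Cartan subalgebra to its dual.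
\<close>

definition standard_form ::
    "int ^ 'n ^ 'n \<Rightarrow> ('g::ab_group_add, 'n) kac_moody_data \<Rightarrow>
     (('g \<Rightarrow> complex) \<Rightarrow> ('g \<Rightarrow> complex) \<Rightarrow> complex) \<Rightarrow> bool" where
  "standard_form A \<gg> F \<longleftrightarrow>
     (\<exists>B. standard_form_on_cartan A \<gg> B \<and>
        (\<forall>x\<in>cartan \<gg>. \<forall>y\<in>cartan \<gg>.
           F (\<lambda>h. if h \<in> cartan \<gg> then B x h else 0)
             (\<lambda>h. if h \<in> cartan \<gg> then B y h else 0) = B x y))"


section \<open>Subsets of real roots and the subalgebras they generate\<close>

definition reflection ::
    "(('g \<Rightarrow> complex) \<Rightarrow> ('g \<Rightarrow> complex) \<Rightarrow> complex) \<Rightarrow>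
     ('g \<Rightarrow> complex) \<Rightarrow> ('g \<Rightarrow> complex) \<Rightarrow> ('g \<Rightarrow> complex)" where
  "reflection F \<alpha> \<beta> = (\<lambda>h. \<beta> h - 2 * F \<beta> \<alpha> / F \<alpha> \<alpha> * \<alpha> h)"

definition closed_subroot_system ::
    "('g::ab_group_add, 'n) kac_moody_data \<Rightarrow>
     (('g \<Rightarrow> complex) \<Rightarrow> ('g \<Rightarrow> complex) \<Rightarrow> complex) \<Rightarrow> ('g \<Rightarrow> complex) set \<Rightarrow> bool" where
  "closed_subroot_system \<gg> F \<Psi> \<longleftrightarrow>
     \<Psi> \<noteq> {} \<and> \<Psi> \<subseteq> real_roots \<gg> \<and>
     (\<forall>\<alpha>\<in>\<Psi>. \<forall>\<beta>\<in>\<Psi>. reflection F \<alpha> \<beta> \<in> \<Psi>) \<and>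
     (\<forall>\<alpha>\<in>\<Psi>. \<forall>\<beta>\<in>\<Psi>. \<alpha> + \<beta> \<in> real_roots \<gg> \<longrightarrow> \<alpha> + \<beta> \<in> \<Psi>)"

definition pi_system ::
    "('g::ab_group_add, 'n) kac_moody_data \<Rightarrow> ('g \<Rightarrow> complex) set \<Rightarrow> bool" where
  "pi_system \<gg> S \<longleftrightarrow>
     S \<noteq> {} \<and> finite S \<and> S \<subseteq> real_roots \<gg> \<and> (\<forall>\<alpha>\<in>S. \<forall>\<beta>\<in>S. \<alpha> - \<beta> \<notin> roots \<gg>)"

definition symmetric_subset ::
    "('g::ab_group_add, 'n) kac_moody_data \<Rightarrow> ('g \<Rightarrow> complex) set \<Rightarrow> bool" where
  "symmetric_subset \<gg> S \<longleftrightarrow> S \<noteq> {} \<and> S \<subseteq> real_roots \<gg> \<and> uminus ` S = S"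

definition generated_subalgebra ::
    "('g::ab_group_add, 'n) kac_moody_data \<Rightarrow> ('g \<Rightarrow> complex) set \<Rightarrow> 'g set" where
  "generated_subalgebra \<gg> S =
     lie_subalgebra (scl \<gg>) (brk \<gg>) hull (\<Union>\<alpha>\<in>S. root_space \<gg> \<alpha>)"

end

theory Submission
  imports Defs
begin

text \<open>
  Every real root \<open>\<alpha>\<close> is conjugate to a simple root under automorphisms of the algebra. Hence
  the root spaces of \<open>\<alpha>\<close> and \<open>- \<alpha>\<close> are lines spanned by the outer elements of an
  sl(2)-triple whose middle element is the coroot of \<open>\<alpha>\<close>, and the reflection in \<open>\<alpha>\<close> lifts
  to an automorphism made of exponentials of these elements. A subalgebra that contains
  both lines is stable under this automorphism (\<open>real_root_spaces_reflection\<close>). Moreover, if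
  \<open>\<alpha>\<close>, \<open>\<beta>\<close> and \<open>\<alpha> + \<beta>\<close> are real roots, the bracket of the root spaces of \<open>\<alpha>\<close> and
  \<open>\<beta>\<close> is the root space of \<open>\<alpha> + \<beta>\<close> (\<open>real_root_spaces_bracket\<close>). So for any subalgebra
  the real roots \<open>\<alpha>\<close> such that it contains the root spaces of \<open>\<alpha>\<close> and \<open>- \<alpha>\<close> are stable
  under reflections and real sums. For the algebra generated by a symmetric subset they form a closed
  subroot system generating the same algebra. In the other direction a closed subroot system is
  symmetric, since the reflection of \<open>\<alpha>\<close> in itself is \<open>- \<alpha>\<close>, and so is the union of a
  pi-system with its negative.

  There remains the construction of a pi-system for a closed subroot system \<open>P\<close>. Take the positive
  roots in \<open>P\<close> whose root spaces are not generated by the roots of \<open>P\<close> of smaller height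
  (\<open>base\<close>). They generate by induction on the height (\<open>base_generates\<close>). Suppose that two
  of them, \<open>a\<close> and the lower \<open>b\<close>, differ by a root. If \<open>a - b\<close> is real, then \<open>a\<close> is the
  sum of the lower roots \<open>b\<close> and \<open>a - b\<close> of \<open>P\<close>. If it is imaginary, it is isotropic, and
  in affine type the form is positive semidefinite, so \<open>a - b\<close> is orthogonal to everything; then
  the reflection of \<open>a\<close> in \<open>b\<close> is \<open>a - 2 b\<close>, which is closer to zero than \<open>a\<close>. Both
  cases contradict the choice of \<open>a\<close> (\<open>generated_by_lower\<close>). The same argument shows that
  all base elements in one coset of the radical of the form have the same height. Since the real
  roots take only finitely many values on each simple coroot, the base is finite
  (\<open>base_finite\<close>).

  The facts about the algebra behind this are derived from its presentation. It is spanned by the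
  Cartan subalgebra and by the iterated brackets of the \<open>e i\<close> and those of the \<open>f i\<close>
  (\<open>triangular_decomposition\<close>), which gives every root a sign and makes the root spaces of simple
  roots lines. The absence of ideals that meet the Cartan subalgebra trivially yields the Serre
  relations, hence local nilpotency of the generators, and so the reflection automorphisms. That
  roots which are not real are isotropic follows by moving a root of positive norm
  towards zero with simple reflections (\<open>real_root_if_positive_norm\<close>).
\<close>

section \<open>Brackets and nilpotent exponentials\<close>

context lie_algebra
begin

lemma br_linear:
  "br x (y + z) = br x y + br x z" "br (x + y) z = br x z + br y z"
  "br x (y - z) = br x y - br x z" "br (x - y) z = br x z - br y z"
  "br x (scl c y) = scl c (br x y)" "br (scl c x) y = scl c (br x y)"
  "br x 0 = 0" "br 0 x = 0" "br x (- y) = - br x y" "br (- x) y = - br x y"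
proof -
  interpret r: Vector_Spaces.linear scl scl "\<lambda>y. br x y" for x by (rule linear_right)
  interpret l: Vector_Spaces.linear scl scl "\<lambda>x. br x y" for y by (rule linear_left)
  show "br x (y + z) = br x y + br x z" "br (x + y) z = br x z + br y z"
    "br x (y - z) = br x y - br x z" "br (x - y) z = br x z - br y z"
    "br x (scl c y) = scl c (br x y)" "br (scl c x) y = scl c (br x y)"
    "br x 0 = 0" "br 0 x = 0" "br x (- y) = - br x y" "br (- x) y = - br x y"
    by (simp_all add: r.add l.add r.diff l.diff r.scale l.scale r.zero l.zero r.neg l.neg)
qed

lemma br_sum_right: "br x (\<Sum>i\<in>I. y i) = (\<Sum>i\<in>I. br x (y i))"
  by (induction I rule: infinite_finite_induct) (simp_all add: br_linear)

lemma br_sum_left: "br (\<Sum>i\<in>I. y i) x = (\<Sum>i\<in>I. br (y i) x)"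
  by (induction I rule: infinite_finite_induct) (simp_all add: br_linear)

lemma br_skew: "br y x = - br x y"
proof -
  have "br (x + y) (x + y) = 0" by (rule alternating)
  then have "br x x + br y x + (br x y + br y y) = 0" by (simp only: br_linear)
  then have "br x y + br y x = 0" by (simp add: alternating add.commute)
  then show ?thesis by (simp add: eq_neg_iff_add_eq_0 add.commute)
qed

lemma br_derivation: "br x (br y z) = br (br x y) z + br y (br x z)"
proof -
  have "br x (br y z) + br y (br z x) + br z (br x y) = 0" by (rule jacobi)
  moreover have "br y (br z x) = - br y (br x z)" by (subst br_skew) (simp add: br_linear)
  moreover have "br z (br x y) = - br (br x y) z" by (rule br_skew)
  ultimately show ?thesis by (simp add: algebra_simps)
qed

definition ad_pow :: "'g \<Rightarrow> nat \<Rightarrow> 'g \<Rightarrow> 'g" where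
  "ad_pow x n = br x ^^ n"

lemma ad_pow_simps [simp]: "ad_pow x 0 y = y" "ad_pow x (Suc n) y = br x (ad_pow x n y)"
  by (simp_all add: ad_pow_def)

lemma ad_pow_Suc_right: "ad_pow x (Suc n) y = ad_pow x n (br x y)"
  by (induction n) simp_all

lemma ad_pow_add: "ad_pow x (m + n) y = ad_pow x m (ad_pow x n y)"
  by (induction m) simp_all

lemma ad_pow_linear:
  "ad_pow x n (y + z) = ad_pow x n y + ad_pow x n z"
  "ad_pow x n (scl c y) = scl c (ad_pow x n y)"
  "ad_pow x n 0 = 0" "ad_pow x n (- y) = - ad_pow x n y"
  by (induction n) (simp_all add: br_linear)

lemma ad_pow_minus: "ad_pow (- x) n y = scl ((- 1) ^ n) (ad_pow x n y)"
  by (induction n) (simp_all add: br_linear)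

lemma ad_pow_zero_mono: "ad_pow x m y = 0 \<Longrightarrow> m \<le> n \<Longrightarrow> ad_pow x n y = 0"
  by (metis ad_pow_add ad_pow_linear(3) le_add_diff_inverse2)

definition divided_pow :: "'g \<Rightarrow> nat \<Rightarrow> 'g \<Rightarrow> 'g" where
  "divided_pow x n y = scl (1 / fact n) (ad_pow x n y)"

lemma br_divided_pow: "br x (divided_pow x n y) = scl (of_nat (Suc n)) (divided_pow x (Suc n) y)"
  by (simp add: divided_pow_def br_linear del: of_nat_Suc)

text \<open>This is the Leibniz rule for the derivation \<open>br x\<close>; the divided powers absorb the
  binomial coefficients.\<close>

lemma divided_pow_br:
  "divided_pow x n (br y z) = (\<Sum>k\<le>n. br (divided_pow x k y) (divided_pow x (n - k) z))"
proof (induction n)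
  case 0
  then show ?case by (simp add: divided_pow_def)
next
  case (Suc n)
  define g where "g k = br (divided_pow x k y) (divided_pow x (Suc n - k) z)" for k
  have "scl (of_nat (Suc n)) (divided_pow x (Suc n) (br y z))
      = br x (divided_pow x n (br y z))" by (simp only: br_divided_pow)
  also have "\<dots> = (\<Sum>k\<le>n. br (br x (divided_pow x k y)) (divided_pow x (n - k) z)
                    + br (divided_pow x k y) (br x (divided_pow x (n - k) z)))"
    unfolding Suc.IH br_sum_right by (rule sum.cong[OF HOL.refl]) (rule br_derivation)
  also have "\<dots> = (\<Sum>k\<le>n. scl (of_nat (Suc k)) (g (Suc k))) + (\<Sum>k\<le>n. scl (of_nat (Suc n - k)) (g k))"
    unfolding sum.distrib
    by (intro arg_cong2[where f = "(+)"] sum.cong HOL.refl)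
      (simp_all add: br_divided_pow br_linear g_def Suc_diff_le del: of_nat_Suc)
  also have "(\<Sum>k\<le>n. scl (of_nat (Suc k)) (g (Suc k))) = (\<Sum>k\<le>Suc n. scl (of_nat k) (g k))"
    by (subst sum.atMost_Suc_shift) simp
  also have "(\<Sum>k\<le>n. scl (of_nat (Suc n - k)) (g k)) = (\<Sum>k\<le>Suc n. scl (of_nat (Suc n - k)) (g k))"
    by simp
  also have "(\<Sum>k\<le>Suc n. scl (of_nat k) (g k)) + (\<Sum>k\<le>Suc n. scl (of_nat (Suc n - k)) (g k))
      = (\<Sum>k\<le>Suc n. scl (of_nat (Suc n)) (g k))"
    unfolding sum.distrib[symmetric]
  proof (rule sum.cong[OF HOL.refl])
    fix k assume "k \<in> {..Suc n}"
    then have "of_nat k + of_nat (Suc n - k) = (of_nat (Suc n) :: complex)"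
      unfolding of_nat_add[symmetric] by (metis atMost_iff le_add_diff_inverse)
    then show "scl (of_nat k) (g k) + scl (of_nat (Suc n - k)) (g k) = scl (of_nat (Suc n)) (g k)"
      by (metis scale_left_distrib)
  qed
  also have "\<dots> = scl (of_nat (Suc n)) (\<Sum>k\<le>Suc n. g k)" by (simp only: scale_sum_right)
  finally have "divided_pow x (Suc n) (br y z) = (\<Sum>k\<le>Suc n. g k)"
    by (metis scale_left_imp_eq of_nat_eq_0_iff nat.distinct(2))
  then show ?case by (simp add: g_def)
qed

definition locally_ad_nilpotent :: "'g \<Rightarrow> bool" where
  "locally_ad_nilpotent x \<longleftrightarrow> (\<forall>y. \<exists>n. ad_pow x n y = 0)"

lemma locally_ad_nilpotent_minus: "locally_ad_nilpotent x \<Longrightarrow> locally_ad_nilpotent (- x)"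
  by (auto simp: locally_ad_nilpotent_def ad_pow_minus)

text \<open>Summing over the powers that do not vanish gives the exponential series wherever \<open>br x\<close>
  is nilpotent, without a choice of a nilpotency bound.\<close>

definition ad_exp :: "'g \<Rightarrow> 'g \<Rightarrow> 'g" where
  "ad_exp x y = (\<Sum>n | ad_pow x n y \<noteq> 0. divided_pow x n y)"

lemma ad_exp_eq_sum:
  assumes "ad_pow x N y = 0"
  shows "ad_exp x y = (\<Sum>n<N. divided_pow x n y)"
  unfolding ad_exp_def
proof (rule sum.mono_neutral_left)
  show "{n. ad_pow x n y \<noteq> 0} \<subseteq> {..<N}"
    using ad_pow_zero_mono[OF assms] by (auto simp: not_less[symmetric])
qed (auto simp: divided_pow_def)

lemma ad_exp_add:
  assumes "locally_ad_nilpotent x"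
  shows "ad_exp x (y + z) = ad_exp x y + ad_exp x z"
proof -
  obtain M N where "ad_pow x M y = 0" "ad_pow x N z = 0"
    using assms unfolding locally_ad_nilpotent_def by blast
  then have "ad_pow x (M + N) y = 0" "ad_pow x (M + N) z = 0"
    using ad_pow_zero_mono by (metis le_add1 le_add2)+
  then show ?thesis
    by (simp add: ad_exp_eq_sum[of _ "M + N"] ad_pow_linear divided_pow_def scale_right_distrib
        sum.distrib)
qed

lemma ad_exp_scale:
  assumes "locally_ad_nilpotent x"
  shows "ad_exp x (scl c y) = scl c (ad_exp x y)"
proof -
  obtain M where "ad_pow x M y = 0"
    using assms unfolding locally_ad_nilpotent_def by blast
  then show ?thesis
    by (simp add: ad_exp_eq_sum[of _ M] ad_pow_linear divided_pow_def scale_sum_right mult.commute)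
qed

end

lemma sum_triangle_eq_square:
  fixes g :: "nat \<Rightarrow> nat \<Rightarrow> 'a::comm_monoid_add"
  assumes "\<And>k l. k \<ge> M \<or> l \<ge> M \<Longrightarrow> g k l = 0"
  shows "(\<Sum>n<2*M. \<Sum>k\<le>n. g k (n - k)) = (\<Sum>k<M. \<Sum>l<M. g k l)"
proof -
  have "(\<Sum>n<2*M. \<Sum>k\<le>n. g k (n - k)) = (\<Sum>(n, k) \<in> Sigma {..<2*M} (\<lambda>n. {..n}). g k (n - k))"
    by (simp add: sum.Sigma)
  also have "\<dots> = (\<Sum>(k, l) \<in> {(k, l). k + l < 2*M}. g k l)"
    by (rule sum.reindex_bij_witness[of _ "\<lambda>(k, l). (k + l, k)" "\<lambda>(n, k). (k, n - k)"]) auto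
  also have "\<dots> = (\<Sum>(k, l) \<in> {..<M} \<times> {..<M}. g k l)"
  proof (rule sum.mono_neutral_right)
    have "{(k, l). k + l < 2*M} \<subseteq> {..<2*M} \<times> {..<2*M}" by auto
    then show "finite {(k, l). k + l < 2*M}" by (rule finite_subset) simp
    show "\<forall>i\<in>{(k, l). k + l < 2 * M} - {..<M} \<times> {..<M}. (case i of (k, l) \<Rightarrow> g k l) = 0"
      using assms by (auto simp flip: not_less)
  qed auto
  finally show ?thesis by (simp add: sum.cartesian_product)
qed

context lie_algebra
begin

text \<open>By the Leibniz rule the two sides are the same double series, summed over the triangles
  \<open>k + l = n\<close> on the left and over a square on the right.\<close>

lemma ad_exp_br:
  assumes "locally_ad_nilpotent x"
  shows "ad_exp x (br y z) = br (ad_exp x y) (ad_exp x z)"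
proof -
  obtain M1 M2 M3 where M: "ad_pow x M1 y = 0" "ad_pow x M2 z = 0" "ad_pow x M3 (br y z) = 0"
    using assms unfolding locally_ad_nilpotent_def by blast
  define M where "M = M1 + M2 + M3"
  have M': "ad_pow x n y = 0" "ad_pow x n z = 0" "ad_pow x n (br y z) = 0" if "n \<ge> M" for n
    using that M ad_pow_zero_mono unfolding M_def
    by (meson add_leE)+
  have "ad_exp x (br y z) = (\<Sum>n<2*M. \<Sum>k\<le>n. br (divided_pow x k y) (divided_pow x (n - k) z))"
    by (subst ad_exp_eq_sum[of _ "2*M"]) (simp_all add: M' divided_pow_br)
  also have "\<dots> = (\<Sum>k<M. \<Sum>l<M. br (divided_pow x k y) (divided_pow x l z))"
    by (rule sum_triangle_eq_square) (auto simp: divided_pow_def M' br_linear)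
  also have "\<dots> = br (ad_exp x y) (ad_exp x z)"
    unfolding ad_exp_eq_sum[OF M'(1)[OF order_refl]] ad_exp_eq_sum[OF M'(2)[OF order_refl]]
      br_sum_left br_sum_right by (rule sum.swap)
  finally show ?thesis .
qed

text \<open>The terms of total degree \<open>n\<close> add up to the multiple \<open>(1 + - 1) ^ n / fact n\<close> of
  the \<open>n\<close>-th power.\<close>

lemma ad_exp_minus_inverse:
  assumes "locally_ad_nilpotent x"
  shows "ad_exp x (ad_exp (- x) y) = y"
proof -
  obtain M where M0: "ad_pow x M y = 0"
    using assms unfolding locally_ad_nilpotent_def by blast
  have M: "ad_pow x n y = 0" if "n \<ge> M" for n
    using that M0 ad_pow_zero_mono by blast
  define g where "g k l = scl (1 / fact k * ((- 1) ^ l / fact l)) (ad_pow x (k + l) y)" for k l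
  have dp: "divided_pow x k (divided_pow (- x) l y) = g k l" for k l
    by (simp add: divided_pow_def ad_pow_minus g_def ad_pow_linear ad_pow_add mult.assoc)
  have exp_sum: "ad_exp x (\<Sum>l\<in>I. w l) = (\<Sum>l\<in>I. ad_exp x (w l))" for w :: "nat \<Rightarrow> 'g" and I
    by (induction I rule: infinite_finite_induct)
      (simp_all add: ad_exp_add[OF assms] ad_exp_eq_sum[of _ 0])
  have "ad_exp x (ad_exp (- x) y) = (\<Sum>l<M. ad_exp x (divided_pow (- x) l y))"
    by (simp add: ad_exp_eq_sum[of "- x" M] ad_pow_minus M exp_sum)
  also have "\<dots> = (\<Sum>l<M. \<Sum>k<M. g k l)"
  proof (rule sum.cong[OF HOL.refl])
    fix l
    have "ad_pow x M (divided_pow (- x) l y) = 0"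
      by (simp add: divided_pow_def ad_pow_minus ad_pow_linear ad_pow_add[symmetric] M)
    then show "ad_exp x (divided_pow (- x) l y) = (\<Sum>k<M. g k l)"
      by (simp add: ad_exp_eq_sum dp)
  qed
  also have "\<dots> = (\<Sum>k<M. \<Sum>l<M. g k l)" by (rule sum.swap)
  also have "\<dots> = (\<Sum>n<2*M. \<Sum>k\<le>n. g k (n - k))"
    by (rule sum_triangle_eq_square[symmetric]) (auto simp: g_def M)
  also have "\<dots> = (\<Sum>n<2*M. if n = 0 then y else 0)"
  proof (rule sum.cong[OF HOL.refl])
    fix n
    have "(\<Sum>k\<le>n. g k (n - k)) = scl (\<Sum>k\<le>n. 1 / fact k * ((- 1) ^ (n - k) / fact (n - k))) (ad_pow x n y)"
      by (simp add: g_def scale_sum_left)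
    also have "(\<Sum>k\<le>n. 1 / fact k * ((- 1) ^ (n - k) / fact (n - k)) :: complex)
        = (\<Sum>k\<le>n. of_nat (n choose k) * 1 ^ k * (- 1) ^ (n - k)) / fact n"
      unfolding sum_divide_distrib
      by (intro sum.cong HOL.refl) (simp add: binomial_fact field_simps)
    also have "(\<Sum>k\<le>n. of_nat (n choose k) * 1 ^ k * (- 1) ^ (n - k) :: complex) = (1 + - 1) ^ n"
      by (rule binomial_ring[symmetric])
    finally show "(\<Sum>k\<le>n. g k (n - k)) = (if n = 0 then y else 0)"
      by (cases n) simp_all
  qed
  also have "\<dots> = y"
    using M[of 0] by (cases "M = 0") (simp_all add: sum.delta)
  finally show ?thesis .
qed

lemma lie_subalgebra_sum:
  assumes "lie_subalgebra scl br L" "\<And>i. i \<in> I \<Longrightarrow> x i \<in> L"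
  shows "(\<Sum>i\<in>I. x i) \<in> L"
  using assms unfolding lie_subalgebra_def by (auto intro: subspace_sum)

lemma lie_subalgebra_ad_exp:
  assumes L: "lie_subalgebra scl br L" and "x \<in> L" "y \<in> L"
  shows "ad_exp x y \<in> L"
proof -
  have "ad_pow x n y \<in> L" for n
    using assms by (induction n) (auto simp: lie_subalgebra_def)
  then have "divided_pow x n y \<in> L" for n
    using L unfolding divided_pow_def lie_subalgebra_def by (auto intro: subspace_scale)
  then show ?thesis
    unfolding ad_exp_def by (intro lie_subalgebra_sum[OF L])
qed

lemma lie_subalgebra_hull: "lie_subalgebra scl br (lie_subalgebra scl br hull X)"
proof (rule hull_in)
  fix C assume "Ball C (lie_subalgebra scl br)"
  then show "lie_subalgebra scl br (\<Inter> C)"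
    unfolding lie_subalgebra_def by (auto intro: subspace_Inter)
qed

text \<open>Because of this, it is enough to check local nilpotency of \<open>br x\<close> on generators of the
  algebra. Closure under brackets is the Leibniz rule once more: in degree \<open>M + N\<close> one of the
  two factors of each term vanishes.\<close>

lemma lie_subalgebra_nilpotent: "lie_subalgebra scl br {y. \<exists>n. ad_pow x n y = 0}"
  unfolding lie_subalgebra_def
proof (intro conjI ballI)
  show "subspace {y. \<exists>n. ad_pow x n y = 0}"
  proof (rule subspaceI)
    fix y z assume "y \<in> {y. \<exists>n. ad_pow x n y = 0}" "z \<in> {y. \<exists>n. ad_pow x n y = 0}"
    then obtain M N where "ad_pow x M y = 0" "ad_pow x N z = 0" by auto
    then have "ad_pow x (M + N) (y + z) = 0"
      using ad_pow_zero_mono by (metis le_add1 le_add2 ad_pow_linear(1) add_0)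
    then show "y + z \<in> {y. \<exists>n. ad_pow x n y = 0}" by blast
  next
    fix c y assume "y \<in> {y. \<exists>n. ad_pow x n y = 0}"
    then show "scl c y \<in> {y. \<exists>n. ad_pow x n y = 0}"
      by (auto simp: ad_pow_linear)
  qed (auto simp: ad_pow_linear)
next
  fix y z assume "y \<in> {y. \<exists>n. ad_pow x n y = 0}" "z \<in> {y. \<exists>n. ad_pow x n y = 0}"
  then obtain M N where MN: "ad_pow x M y = 0" "ad_pow x N z = 0" by auto
  have "br (divided_pow x k y) (divided_pow x (M + N - k) z) = 0" for k
    using ad_pow_zero_mono[OF MN(1), of k] ad_pow_zero_mono[OF MN(2), of "M + N - k"]
    by (cases "M \<le> k") (auto simp: divided_pow_def br_linear)
  then have "divided_pow x (M + N) (br y z) = 0"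
    by (simp add: divided_pow_br)
  then have "ad_pow x (M + N) (br y z) = 0"
    by (simp add: divided_pow_def)
  then show "br y z \<in> {y. \<exists>n. ad_pow x n y = 0}" by blast
qed

end

section \<open>Triples spanning a copy of sl(2)\<close>

context lie_algebra
begin

text \<open>Local nilpotency is part of the notion because it makes the exponentials of \<open>e\<close> and
  \<open>f\<close> available.\<close>

definition sl2_triple :: "'g \<Rightarrow> 'g \<Rightarrow> 'g \<Rightarrow> bool" where
  "sl2_triple e f h \<longleftrightarrow> br e f = h \<and> br h e = scl 2 e \<and> br h f = scl (- 2) f \<and>
     locally_ad_nilpotent e \<and> locally_ad_nilpotent f"

lemma sl2_triple_swap: "sl2_triple e f h \<Longrightarrow> sl2_triple f e (- h)"
  unfolding sl2_triple_def by (auto simp: br_linear br_skew[of f e])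

text \<open>The familiar computation for a lowest weight vector, \<open>br f y = 0\<close>, works under the weaker
  hypothesis that \<open>br f y\<close> is killed by \<open>e\<close>. The first case yields the Serre relations, the
  general one the nonvanishing of brackets of real root spaces.\<close>

lemma br_lowering_raising_power:
  assumes ef: "br e f = h" and he: "br h e = scl 2 e"
    and hy: "br h y = scl \<mu> y" and efy: "br e (br f y) = 0"
  shows "br f (ad_pow e (Suc k) y) = scl (- (of_nat (Suc k) * (\<mu> + of_nat k))) (ad_pow e k y)"
proof (induction k)
  case 0
  have "br f (br e y) = br (br f e) y + br e (br f y)" by (rule br_derivation)
  moreover have "br f e = - h" using br_skew[of e f] ef by simp
  ultimately show ?case by (simp add: efy hy br_linear)
next
  case (Suc k)
  define z where "z = ad_pow e (Suc k) y"
  have wt: "br h (ad_pow e n y) = scl (\<mu> + 2 * of_nat n) (ad_pow e n y)" for n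
  proof (induction n)
    case (Suc n)
    have "br h (br e (ad_pow e n y)) = br (br h e) (ad_pow e n y) + br e (br h (ad_pow e n y))"
      by (rule br_derivation)
    also have "\<dots> = scl (2 + (\<mu> + 2 * of_nat n)) (br e (ad_pow e n y))"
      by (simp only: he br_linear Suc.IH scale_left_distrib)
    finally show ?case by (simp add: algebra_simps)
  qed (simp add: hy)
  have "br f (br e z) = br (br f e) z + br e (br f z)" by (rule br_derivation)
  also have "br f e = - h" using br_skew[of e f] ef by simp
  also have "br (- h) z = scl (- (\<mu> + 2 * of_nat (Suc k))) z"
    by (simp only: br_linear z_def wt scale_minus_left)
  also have "br e (br f z) = scl (- (of_nat (Suc k) * (\<mu> + of_nat k))) z"
    by (simp only: z_def Suc.IH br_linear) simp
  finally have "br f (br e z)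
      = scl (- (\<mu> + 2 * of_nat (Suc k)) + - (of_nat (Suc k) * (\<mu> + of_nat k))) z"
    by (simp only: scale_left_distrib)
  also have "- (\<mu> + 2 * of_nat (Suc k)) + - (of_nat (Suc k) * (\<mu> + of_nat k))
      = - (of_nat (Suc (Suc k)) * (\<mu> + of_nat (Suc k)))"
    by (simp add: algebra_simps)
  finally show ?case by (simp add: z_def)
qed

text \<open>If lowering \<open>y\<close> and raising it again gave zero, then by the formula above \<open>br f\<close> would
  take each \<open>ad_pow e (Suc k) y\<close> to a nonzero multiple of \<open>ad_pow e k y\<close>, so no power of
  \<open>br e\<close> could kill \<open>y\<close>.\<close>

lemma br_raise_lower_nonzero:
  fixes \<mu> :: real
  assumes "sl2_triple e f h" "br h y = scl (of_real \<mu>) y" "\<mu> > 0" "y \<noteq> 0"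
  shows "br e (br f y) \<noteq> 0"
proof
  assume efy: "br e (br f y) = 0"
  have "ad_pow e k y \<noteq> 0" for k
  proof (induction k)
    case (Suc k)
    have "br f (ad_pow e (Suc k) y)
        = scl (- (of_nat (Suc k) * (of_real \<mu> + of_nat k))) (ad_pow e k y)"
      using br_lowering_raising_power assms efy unfolding sl2_triple_def by blast
    moreover have "of_nat (Suc k) * (of_real \<mu> + of_nat k) = (of_real (real (Suc k) * (\<mu> + real k)) :: complex)"
      by simp
    moreover have "real (Suc k) * (\<mu> + real k) \<noteq> 0" using \<open>\<mu> > 0\<close> by simp
    ultimately show ?case
      using Suc.IH by (metis br_linear(7) neg_equal_0_iff_equal of_real_eq_0_iff scale_eq_0_iff)
  qed (simp add: \<open>y \<noteq> 0\<close>)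
  then show False
    using assms(1) unfolding sl2_triple_def locally_ad_nilpotent_def by blast
qed

definition lie_automorphism :: "('g \<Rightarrow> 'g) \<Rightarrow> bool" where
  "lie_automorphism \<tau> \<longleftrightarrow> bij \<tau> \<and> (\<forall>x y. \<tau> (x + y) = \<tau> x + \<tau> y) \<and>
     (\<forall>c x. \<tau> (scl c x) = scl c (\<tau> x)) \<and> (\<forall>x y. \<tau> (br x y) = br (\<tau> x) (\<tau> y))"

lemma lie_automorphism_comp:
  "lie_automorphism \<sigma> \<Longrightarrow> lie_automorphism \<tau> \<Longrightarrow> lie_automorphism (\<sigma> \<circ> \<tau>)"
  unfolding lie_automorphism_def by (auto intro: bij_comp)

lemma lie_automorphism_zero: "lie_automorphism \<tau> \<Longrightarrow> \<tau> 0 = 0"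
  unfolding lie_automorphism_def by (metis scale_zero_left)

lemma lie_automorphism_eq_zero_iff: "lie_automorphism \<tau> \<Longrightarrow> \<tau> x = 0 \<longleftrightarrow> x = 0"
  using lie_automorphism_zero unfolding lie_automorphism_def by (metis bij_pointE)

lemma lie_automorphism_nilpotent:
  assumes "lie_automorphism \<tau>" "locally_ad_nilpotent x"
  shows "locally_ad_nilpotent (\<tau> x)"
  unfolding locally_ad_nilpotent_def
proof
  fix y
  obtain z where z: "y = \<tau> z"
    using assms unfolding lie_automorphism_def by (metis bij_pointE)
  have "ad_pow (\<tau> x) n y = \<tau> (ad_pow x n z)" for n
    using assms by (induction n) (auto simp: z lie_automorphism_def)
  then show "\<exists>n. ad_pow (\<tau> x) n y = 0"
    using assms(2) lie_automorphism_zero[OF assms(1)] unfolding locally_ad_nilpotent_def by metis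
qed

lemma lie_automorphism_ad_exp:
  assumes "locally_ad_nilpotent x"
  shows "lie_automorphism (ad_exp x)"
  unfolding lie_automorphism_def
proof (intro conjI allI)
  show "bij (ad_exp x)"
  proof (rule o_bij[of "ad_exp (- x)"])
    show "ad_exp (- x) \<circ> ad_exp x = id"
      using ad_exp_minus_inverse[OF locally_ad_nilpotent_minus[OF assms]] by (auto simp: fun_eq_iff)
    show "ad_exp x \<circ> ad_exp (- x) = id"
      using ad_exp_minus_inverse[OF assms] by (auto simp: fun_eq_iff)
  qed
qed (simp_all add: assms ad_exp_add ad_exp_scale ad_exp_br)

text \<open>The classical product of three exponentials that lifts a reflection from the Cartan
  subalgebra to the whole algebra.\<close>

definition sl2_reflection :: "'g \<Rightarrow> 'g \<Rightarrow> 'g \<Rightarrow> 'g" where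
  "sl2_reflection e f = ad_exp e \<circ> ad_exp (- f) \<circ> ad_exp e"

lemma lie_automorphism_sl2_reflection:
  "sl2_triple e f h \<Longrightarrow> lie_automorphism (sl2_reflection e f)"
  unfolding sl2_reflection_def sl2_triple_def
  by (intro lie_automorphism_comp lie_automorphism_ad_exp) (auto intro: locally_ad_nilpotent_minus)

lemma lie_subalgebra_sl2_reflection:
  assumes "lie_subalgebra scl br L" "e \<in> L" "f \<in> L" "x \<in> L"
  shows "sl2_reflection e f x \<in> L"
proof -
  have "- f \<in> L" using assms unfolding lie_subalgebra_def by (auto intro: subspace_neg)
  then show ?thesis
    unfolding sl2_reflection_def using assms by (simp add: lie_subalgebra_ad_exp)
qed

text \<open>On the span of \<open>k\<close>, \<open>e\<close>, \<open>f\<close> and \<open>h\<close> all three exponential series stop after the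
  quadratic term.\<close>

lemma sl2_reflection_toral:
  assumes t: "sl2_triple e f h" and ke: "br k e = scl a e" and kf: "br k f = scl (- a) f"
  shows "sl2_reflection e f k = k - scl a h"
proof -
  have ef: "br e f = h" and he: "br h e = scl 2 e" and hf: "br h f = scl (- 2) f"
    and "locally_ad_nilpotent e" "locally_ad_nilpotent f"
    using t unfolding sl2_triple_def by auto
  then have aut: "lie_automorphism (ad_exp e)" "lie_automorphism (ad_exp (- f))"
    by (auto intro!: lie_automorphism_ad_exp locally_ad_nilpotent_minus)
  have diff: "\<tau> (x - y) = \<tau> x - \<tau> y" if "lie_automorphism \<tau>" for \<tau> x y
    using that unfolding lie_automorphism_def by (metis add_diff_cancel diff_add_cancel)
  have scale: "\<tau> (scl c y) = scl c (\<tau> y)" if "lie_automorphism \<tau>" for \<tau> c y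
    using that unfolding lie_automorphism_def by blast
  have ek: "br e k = - scl a e" and eh: "br e h = - scl 2 e"
    and fk: "br f k = scl a f" and fh: "br f h = scl 2 f" and fe: "br f e = - h"
    using br_skew[of k e] br_skew[of h e] br_skew[of k f] br_skew[of h f] br_skew[of e f]
      ke he kf hf ef by simp_all
  have e1: "ad_exp e k = k - scl a e"
    by (subst ad_exp_eq_sum[of _ 2]) (simp_all add: numeral_2_eq_2 divided_pow_def ek br_linear alternating)
  have e2: "ad_exp e h = h - scl 2 e"
    by (subst ad_exp_eq_sum[of _ 2]) (simp_all add: numeral_2_eq_2 divided_pow_def eh br_linear alternating)
  have e3: "ad_exp e e = e"
    by (subst ad_exp_eq_sum[of _ 1]) (simp_all add: divided_pow_def alternating)
  have f1: "ad_exp (- f) k = k - scl a f"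
    by (subst ad_exp_eq_sum[of _ 2]) (simp_all add: numeral_2_eq_2 divided_pow_def fk br_linear alternating)
  have f2: "ad_exp (- f) e = e + h - f"
    by (subst ad_exp_eq_sum[of _ 3])
      (simp_all add: numeral_3_eq_3 divided_pow_def fe fh br_linear alternating)
  have "ad_exp (- f) (ad_exp e k) = k - scl a f - scl a (e + h - f)"
    by (simp only: e1 diff[OF aut(2)] scale[OF aut(2)] f1 f2)
  also have "\<dots> = k - scl a e - scl a h"
    by (simp add: scale_right_distrib scale_right_diff_distrib)
  finally have "sl2_reflection e f k = ad_exp e k - scl a (ad_exp e e) - scl a (ad_exp e h)"
    by (simp add: sl2_reflection_def diff[OF aut(1)] scale[OF aut(1)])
  also have "\<dots> = k - scl a h + (scl (2 * a) e - scl a e - scl a e)"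
    by (simp add: e1 e2 e3 scale_right_diff_distrib mult.commute)
  also have "scl (2 * a) e - scl a e - scl a e = 0"
    by (simp flip: scale_left_diff_distrib)
  finally show ?thesis by simp
qed

end

section \<open>Root space decomposition\<close>

text \<open>Roots are handled through their coordinates in the basis of simple roots, which show
  whether a root is positive and how high it is.\<close>

definition weight :: "('g::ab_group_add, 'n::finite) kac_moody_data \<Rightarrow> ('n \<Rightarrow> int) \<Rightarrow> 'g \<Rightarrow> complex" where
  "weight \<gg> c = (\<lambda>x. \<Sum>i\<in>UNIV. of_int (c i) * simple_root \<gg> i x)"

definition unit_wt :: "'n \<Rightarrow> 'n \<Rightarrow> int" where
  "unit_wt i = (\<lambda>j. if j = i then 1 else 0)"

definition letter_count :: "'n list \<Rightarrow> 'n \<Rightarrow> int" where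
  "letter_count is = (\<lambda>j. int (count_list is j))"

lemma letter_count_simps [simp]: "letter_count [] = 0" "letter_count (i # is) = unit_wt i + letter_count is"
  by (auto simp: letter_count_def unit_wt_def fun_eq_iff)

lemma letter_count_nonneg: "letter_count is j \<ge> 0"
  by (simp add: letter_count_def)

lemma letter_count_eq_0_iff: "letter_count is j = 0 \<longleftrightarrow> j \<notin> set is"
  by (simp add: letter_count_def count_list_0_iff)

lemma weight_add: "weight \<gg> (c + d) = weight \<gg> c + weight \<gg> d"
  by (simp add: weight_def fun_eq_iff algebra_simps sum.distrib)

lemma weight_uminus: "weight \<gg> (- c) = - weight \<gg> c"
  by (simp add: weight_def fun_eq_iff sum_negf)

lemma weight_diff: "weight \<gg> (c - d) = weight \<gg> c - weight \<gg> d"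
  by (simp add: weight_def fun_eq_iff algebra_simps sum_subtractf)

lemma weight_zero: "weight \<gg> 0 = 0"
  by (simp add: weight_def fun_eq_iff)

lemma weight_unit_wt: "weight \<gg> (unit_wt i) = simple_root \<gg> i"
proof
  fix x
  have "weight \<gg> (unit_wt i) x = (\<Sum>j\<in>UNIV. if j = i then simple_root \<gg> j x else 0)"
    unfolding weight_def unit_wt_def by (intro sum.cong) auto
  then show "weight \<gg> (unit_wt i) x = simple_root \<gg> i x" by simp
qed

definition e_word :: "('g, 'n) kac_moody_data \<Rightarrow> 'n list \<Rightarrow> 'g \<Rightarrow> 'g" where
  "e_word \<gg> is x = foldr (\<lambda>i. brk \<gg> (chev_e \<gg> i)) is x"

lemma e_word_simps [simp]:
  "e_word \<gg> [] x = x" "e_word \<gg> (i # is) x = brk \<gg> (chev_e \<gg> i) (e_word \<gg> is x)"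
  by (simp_all add: e_word_def)

definition e_words :: "('g, 'n) kac_moody_data \<Rightarrow> 'g set" where
  "e_words \<gg> = {e_word \<gg> is (chev_e \<gg> j) |is j. True}"

text \<open>Exchanging the generators \<open>e i\<close> and \<open>f i\<close> and negating roots and coroots gives the same
  Lie algebra with the roles of positive and negative roots exchanged. Every statement about
  the \<open>e i\<close> therefore also holds for the \<open>f i\<close>.\<close>

definition chevalley_swap :: "('g::ab_group_add, 'n) kac_moody_data \<Rightarrow> ('g, 'n) kac_moody_data" where
  "chevalley_swap \<gg> = \<gg>\<lparr>simple_root := \<lambda>i. - simple_root \<gg> i,
     simple_coroot := \<lambda>i. - simple_coroot \<gg> i, chev_e := chev_f \<gg>, chev_f := chev_e \<gg>\<rparr>"

lemma chevalley_swap_simps [simp]: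
  "scl (chevalley_swap \<gg>) = scl \<gg>" "brk (chevalley_swap \<gg>) = brk \<gg>"
  "cartan (chevalley_swap \<gg>) = cartan \<gg>"
  "simple_root (chevalley_swap \<gg>) i = - simple_root \<gg> i"
  "simple_coroot (chevalley_swap \<gg>) i = - simple_coroot \<gg> i"
  "chev_e (chevalley_swap \<gg>) = chev_f \<gg>" "chev_f (chevalley_swap \<gg>) = chev_e \<gg>"
  "dual_cartan (chevalley_swap \<gg>) = dual_cartan \<gg>"
  "root_space (chevalley_swap \<gg>) = root_space \<gg>"
  "weight (chevalley_swap \<gg>) c = - weight \<gg> c"
  by (simp_all add: chevalley_swap_def dual_cartan_def root_space_def weight_def fun_eq_iff sum_negf)

context kac_moody_algebra
begin

abbreviation "br \<equiv> brk \<gg>"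
abbreviation "sc \<equiv> scl \<gg>"
abbreviation "e \<equiv> chev_e \<gg>"
abbreviation "f \<equiv> chev_f \<gg>"
abbreviation "coroot \<equiv> simple_coroot \<gg>"
abbreviation "wt \<equiv> weight \<gg>"
abbreviation "\<R> \<equiv> root_space \<gg>"

lemma dual_cartanD:
  assumes "\<phi> \<in> dual_cartan \<gg>"
  shows "x \<in> cartan \<gg> \<Longrightarrow> y \<in> cartan \<gg> \<Longrightarrow> \<phi> (x + y) = \<phi> x + \<phi> y"
    "x \<in> cartan \<gg> \<Longrightarrow> \<phi> (sc c x) = c * \<phi> x" "x \<notin> cartan \<gg> \<Longrightarrow> \<phi> x = 0"
  using assms unfolding dual_cartan_def by auto

lemma dual_cartan_ext:
  assumes "\<phi> \<in> dual_cartan \<gg>" "\<psi> \<in> dual_cartan \<gg>" "\<And>h. h \<in> cartan \<gg> \<Longrightarrow> \<phi> h = \<psi> h"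
  shows "\<phi> = \<psi>"
proof
  fix h show "\<phi> h = \<psi> h"
    using assms dual_cartanD(3) by (cases "h \<in> cartan \<gg>") metis+
qed

lemma dual_cartan_closed:
  "0 \<in> dual_cartan \<gg>"
  "\<phi> \<in> dual_cartan \<gg> \<Longrightarrow> \<psi> \<in> dual_cartan \<gg> \<Longrightarrow> \<phi> + \<psi> \<in> dual_cartan \<gg>"
  "\<phi> \<in> dual_cartan \<gg> \<Longrightarrow> \<psi> \<in> dual_cartan \<gg> \<Longrightarrow> \<phi> - \<psi> \<in> dual_cartan \<gg>"
  "\<phi> \<in> dual_cartan \<gg> \<Longrightarrow> - \<phi> \<in> dual_cartan \<gg>"
  unfolding dual_cartan_def by (auto simp: algebra_simps)

lemma weight_in_dual: "wt c \<in> dual_cartan \<gg>"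
  unfolding dual_cartan_def
  by (auto simp: weight_def dual_cartanD[OF root_in_dual] algebra_simps sum.distrib sum_distrib_left)

lemma weight_eq_0_iff: "wt c = 0 \<longleftrightarrow> c = 0"
proof
  assume "wt c = 0"
  then have "(\<Sum>i\<in>UNIV. complex_of_int (c i) * simple_root \<gg> i h) = 0" for h
    by (auto simp: weight_def fun_eq_iff)
  then have "complex_of_int (c i) = 0" for i by (rule roots_independent)
  then show "c = 0" by (simp add: fun_eq_iff)
qed (simp add: weight_zero)

lemma weight_inj: "wt c = wt d \<longleftrightarrow> c = d"
  using weight_eq_0_iff[of "c - d"] by (simp add: weight_diff)

lemma root_spaceD: "x \<in> \<R> \<alpha> \<Longrightarrow> h \<in> cartan \<gg> \<Longrightarrow> br h x = sc (\<alpha> h) x"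
  by (simp add: root_space_def)

lemma subspace_root_space: "subspace (\<R> \<alpha>)"
  by (rule subspaceI) (auto simp: root_space_def br_linear scale_right_distrib mult.commute)

lemma br_root_space:
  assumes "x \<in> \<R> \<alpha>" "y \<in> \<R> \<beta>"
  shows "br x y \<in> \<R> (\<alpha> + \<beta>)"
  unfolding root_space_def
proof (intro CollectI ballI)
  fix h assume h: "h \<in> cartan \<gg>"
  have "br h (br x y) = br (br h x) y + br x (br h y)" by (rule br_derivation)
  also have "\<dots> = sc ((\<alpha> + \<beta>) h) (br x y)"
    using assms h by (simp add: root_spaceD br_linear scale_left_distrib)
  finally show "br h (br x y) = sc ((\<alpha> + \<beta>) h) (br x y)" .
qed

lemma e_in_root_space: "e i \<in> \<R> (simple_root \<gg> i)"
  and f_in_root_space: "f i \<in> \<R> (- simple_root \<gg> i)"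
  and cartan_in_root_space: "h \<in> cartan \<gg> \<Longrightarrow> h \<in> \<R> 0"
  by (auto simp: root_space_def rel_he rel_hf rel_hh)

lemma root_space_disjoint:
  assumes "x \<in> \<R> \<alpha>" "x \<in> \<R> \<beta>" "\<alpha> \<in> dual_cartan \<gg>" "\<beta> \<in> dual_cartan \<gg>" "x \<noteq> 0"
  shows "\<alpha> = \<beta>"
proof (rule dual_cartan_ext[OF assms(3,4)])
  fix h assume "h \<in> cartan \<gg>"
  then have "sc (\<alpha> h) x = sc (\<beta> h) x" using assms root_spaceD by metis
  then show "\<alpha> h = \<beta> h" using \<open>x \<noteq> 0\<close> by (rule scale_right_imp_eq[rotated])
qed

text \<open>Applying \<open>br h\<close> and subtracting the multiple by \<open>\<alpha> h\<close> removes the summand of weight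
  \<open>\<alpha>\<close> and, if \<open>h\<close> separates \<open>\<alpha>\<close> from \<open>\<nu>\<close>, rescales the summand of weight
  \<open>\<nu>\<close> by a nonzero factor.\<close>

lemma root_spaces_independent:
  assumes "finite S" "S \<subseteq> dual_cartan \<gg>" "\<And>\<nu>. \<nu> \<in> S \<Longrightarrow> X \<nu> \<in> \<R> \<nu>"
    and "(\<Sum>\<nu>\<in>S. X \<nu>) = 0" "\<nu> \<in> S"
  shows "X \<nu> = 0"
  using assms
proof (induction S arbitrary: X \<nu> rule: finite_induct)
  case (insert \<alpha> S)
  have zero: "X \<nu> = 0" if \<nu>: "\<nu> \<in> S" for \<nu>
  proof -
    have "\<alpha> \<noteq> \<nu>" using that insert.hyps by auto
    moreover have "\<alpha> \<in> dual_cartan \<gg>" "\<nu> \<in> dual_cartan \<gg>" using insert.prems(1) that by auto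
    ultimately obtain h where h: "h \<in> cartan \<gg>" "\<alpha> h \<noteq> \<nu> h"
      by (metis dual_cartan_ext)
    define Y where "Y \<mu> = sc (\<mu> h - \<alpha> h) (X \<mu>)" for \<mu>
    have br_h: "br h (X \<mu>) = sc (\<mu> h) (X \<mu>)" if "\<mu> \<in> insert \<alpha> S" for \<mu>
      using insert.prems(2)[OF that] h root_spaceD by blast
    have "(\<Sum>\<mu>\<in>insert \<alpha> S. Y \<mu>)
        = br h (\<Sum>\<mu>\<in>insert \<alpha> S. X \<mu>) - sc (\<alpha> h) (\<Sum>\<mu>\<in>insert \<alpha> S. X \<mu>)"
      unfolding br_sum_right scale_sum_right sum_subtractf[symmetric] Y_def
      by (rule sum.cong) (auto simp: br_h scale_left_diff_distrib)
    also have "\<dots> = 0" by (simp only: insert.prems(3) br_linear scale_zero_right diff_self)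
    finally have "(\<Sum>\<mu>\<in>S. Y \<mu>) = 0" using insert.hyps by (simp add: Y_def)
    moreover have "Y \<mu> \<in> \<R> \<mu>" if "\<mu> \<in> S" for \<mu>
      unfolding Y_def by (intro subspace_scale subspace_root_space insert.prems(2)) (use that in auto)
    ultimately have "Y \<nu> = 0" using insert.IH[of Y \<nu>] \<nu> insert.prems(1) by auto
    then show ?thesis using h by (auto simp: Y_def)
  qed
  then have "X \<alpha> = 0" using insert.prems(3) insert.hyps by simp
  then show ?case using zero insert.prems(4) by auto
qed simp

text \<open>Grouping a linear combination of weight vectors by weight and comparing it with \<open>x\<close>,
  independence of the root spaces leaves only the terms of weight \<open>\<alpha>\<close>.\<close>

lemma root_space_span:
  assumes W: "\<And>w. w \<in> W \<Longrightarrow> \<exists>\<nu>\<in>dual_cartan \<gg>. w \<in> \<R> \<nu>"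
    and x: "x \<in> span W" "x \<in> \<R> \<alpha>" and \<alpha>: "\<alpha> \<in> dual_cartan \<gg>"
  shows "x \<in> span (W \<inter> \<R> \<alpha>)"
proof -
  obtain t r where t: "finite t" "t \<subseteq> W" and xs: "x = (\<Sum>w\<in>t. sc (r w) w)"
    using x(1) unfolding span_explicit by auto
  obtain p where p: "\<And>w. w \<in> t \<Longrightarrow> p w \<in> dual_cartan \<gg> \<and> w \<in> \<R> (p w)"
    using W t(2) by (metis subsetD)
  define S where "S = insert \<alpha> (p ` t)"
  define Y where "Y \<nu> = (\<Sum>w | w \<in> t \<and> p w = \<nu>. sc (r w) w)" for \<nu>
  \<comment> \<open>the components of \<open>x\<close>, with \<open>x\<close> itself subtracted in weight \<open>\<alpha>\<close>, so that they add up to 0\<close>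
  define X where "X \<nu> = Y \<nu> - (if \<nu> = \<alpha> then x else 0)" for \<nu>
  have S: "finite S" "S \<subseteq> dual_cartan \<gg>" using t p \<alpha> by (auto simp: S_def)
  have "Y \<nu> \<in> \<R> \<nu>" for \<nu>
    unfolding Y_def by (intro subspace_sum subspace_scale subspace_root_space) (use p in auto)
  then have "X \<nu> \<in> \<R> \<nu>" for \<nu>
    unfolding X_def using x(2) by (auto intro!: subspace_diff subspace_root_space)
  moreover have "(\<Sum>\<nu>\<in>S. X \<nu>) = 0"
  proof -
    have "(\<Sum>\<nu>\<in>S. Y \<nu>) = x"
      unfolding Y_def xs using t S by (intro sum.group) (auto simp: S_def)
    moreover have "(\<Sum>\<nu>\<in>S. if \<nu> = \<alpha> then x else 0) = x"
      using S(1) by (subst sum.delta) (auto simp: S_def)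
    ultimately show ?thesis by (simp add: X_def sum_subtractf)
  qed
  ultimately have "X \<alpha> = 0"
    using root_spaces_independent[OF S, of X \<alpha>] by (auto simp: S_def)
  then have "x = Y \<alpha>" by (simp add: X_def)
  also have "Y \<alpha> \<in> span (W \<inter> \<R> \<alpha>)"
    unfolding Y_def by (intro span_sum span_scale span_base) (use t p in auto)
  finally show ?thesis .
qed

lemma kac_moody_algebra_chevalley_swap: "kac_moody_algebra A (chevalley_swap \<gg>)"
proof -
  have lie: "lie_algebra sc br" ..
  have neg: "- x \<in> cartan \<gg> \<longleftrightarrow> x \<in> cartan \<gg>" for x
    by (metis cartan_subspace minus_minus subspace_neg)
  show ?thesis
  proof (rule kac_moody_algebra.intro)
    show "lie_algebra (scl (chevalley_swap \<gg>)) (brk (chevalley_swap \<gg>))" using lie by simp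
    show "kac_moody_algebra_axioms A (chevalley_swap \<gg>)"
    proof (unfold_locales, goal_cases)
      case 1 show ?case by (rule gcm)
    next
      case 2 show ?case using cartan_subspace by simp
    next
      case 3 show ?case using cartan_dim by simp
    next
      case (4 i) show ?case using coroot_in_cartan by (simp add: neg)
    next
      case (5 i) show ?case using root_in_dual by (simp add: dual_cartan_closed)
    next
      case (6 c i)
      then have "(\<Sum>i\<in>UNIV. sc (- c i) (coroot i)) = 0" by simp
      then have "- c i = 0" by (rule coroots_independent)
      then show ?case by simp
    next
      case (7 c i)
      then have "- c i = 0" by (intro roots_independent[of "\<lambda>i. - c i"]) simp
      then show ?case by simp
    next
      case (8 j i)
      have "simple_root \<gg> j (- coroot i) = - simple_root \<gg> j (coroot i)"
        using dual_cartanD(2)[OF root_in_dual coroot_in_cartan, of j "-1" i] by simp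
      then show ?case using pairing by simp
    next
      case (9 i j) show ?case using rel_ef[of j i] br_skew[of "f i" "e j"] by simp
    next
      case (10 h h') then show ?case using rel_hh by simp
    next
      case (11 h i) then show ?case using rel_hf by simp
    next
      case (12 h i) then show ?case using rel_he by simp
    next
      case 13 show ?case using generated by (simp add: Un_commute)
    next
      case (14 I) then show ?case using no_ideals by simp
    qed
  qed
qed

lemma subalgebra_containing_generators:
  assumes "lie_subalgebra sc br M" "range e \<subseteq> M" "range f \<subseteq> M" "cartan \<gg> \<subseteq> M"
  shows "x \<in> M"
proof -
  have "lie_subalgebra sc br hull (range e \<union> range f \<union> cartan \<gg>) \<subseteq> M"
    using assms by (intro hull_minimal) auto
  then show ?thesis using generated by auto
qed

text \<open>By the Jacobi identity the elements that map \<open>V\<close> into itself form a subalgebra, so it is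
  enough to look at generators.\<close>

lemma br_invariant_subspace:
  assumes V: "subspace V" and "\<And>i v. v \<in> V \<Longrightarrow> br (e i) v \<in> V" "\<And>i v. v \<in> V \<Longrightarrow> br (f i) v \<in> V"
    and "\<And>h v. h \<in> cartan \<gg> \<Longrightarrow> v \<in> V \<Longrightarrow> br h v \<in> V" and "v \<in> V"
  shows "br x v \<in> V"
proof -
  have "lie_subalgebra sc br {x. \<forall>v\<in>V. br x v \<in> V}"
    unfolding lie_subalgebra_def
  proof (intro conjI ballI)
    show "subspace {x. \<forall>v\<in>V. br x v \<in> V}"
      using V by (intro subspaceI) (auto simp: br_linear intro: subspace_add subspace_scale subspace_0)
    fix x y assume "x \<in> {x. \<forall>v\<in>V. br x v \<in> V}" "y \<in> {x. \<forall>v\<in>V. br x v \<in> V}"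
    moreover have "br (br x y) v = br x (br y v) - br y (br x v)" for v
      using br_derivation[of x y v] by simp
    ultimately show "br x y \<in> {x. \<forall>v\<in>V. br x v \<in> V}"
      using V by (auto intro!: subspace_diff)
  qed
  then have "x \<in> {x. \<forall>v\<in>V. br x v \<in> V}"
    by (rule subalgebra_containing_generators) (use assms in auto)
  then show ?thesis using assms by auto
qed

lemma br_span:
  assumes "\<And>w. w \<in> W \<Longrightarrow> br x w \<in> span U" "y \<in> span W"
  shows "br x y \<in> span U"
  using assms(2)
proof (induction rule: span_induct)
  show "subspace {y. br x y \<in> span U}"
    by (rule subspaceI) (auto simp: br_linear intro: span_add span_scale span_zero)
qed (use assms(1) in auto)

lemma e_word_root_space:
  "x \<in> \<R> (wt c) \<Longrightarrow> e_word \<gg> is x \<in> \<R> (wt (letter_count is + c))"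
proof (induction "is")
  case (Cons i "is")
  then have "br (e i) (e_word \<gg> is x) \<in> \<R> (wt (unit_wt i) + wt (letter_count is + c))"
    by (intro br_root_space Cons.IH Cons.prems) (simp add: weight_unit_wt e_in_root_space)
  then show ?case by (simp only: e_word_simps letter_count_simps weight_add add.assoc)
qed simp

lemma e_words_root_space: "e_word \<gg> is (e j) \<in> \<R> (wt (letter_count (is @ [j])))"
proof -
  have "letter_count (is @ [j]) = letter_count is + unit_wt j"
    by (auto simp: letter_count_def unit_wt_def fun_eq_iff)
  then show ?thesis using e_word_root_space[of "e j" "unit_wt j" "is"] e_in_root_space
    by (simp add: weight_unit_wt)
qed

lemma br_cartan_e_word:
  assumes "h \<in> cartan \<gg>" "x \<in> \<R> (wt c)"
  shows "br h (e_word \<gg> is x) \<in> span {e_word \<gg> is x |is. True}"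
proof -
  have "br h (e_word \<gg> is x) = sc (wt (letter_count is + c) h) (e_word \<gg> is x)"
    using e_word_root_space[OF assms(2)] assms(1) root_spaceD by blast
  then show ?thesis by (auto intro: span_scale span_base)
qed

lemma br_f_e: "br (f k) (e i) = (if i = k then - coroot i else 0)"
  using br_skew[of "e i" "f k"] rel_ef[of i k] by auto

text \<open>Moving \<open>f k\<close> to the right through a word, each letter \<open>e k\<close> that it meets turns into a
  coroot, which only rescales the rest of the word; at the last letter an element of the Cartan
  subalgebra can remain.\<close>

lemma br_f_e_word:
  "br (f k) (e_word \<gg> is (e j)) \<in> span (e_words \<gg> \<union> cartan \<gg>)"
proof (induction "is")
  case Nil
  show ?case using coroot_in_cartan[of j] by (auto simp: br_f_e intro: span_neg span_base span_zero)
next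
  case (Cons i "is")
  let ?w = "e_word \<gg> is (e j)" and ?V = "span (e_words \<gg> \<union> cartan \<gg>)"
  have w: "?w \<in> e_words \<gg>" unfolding e_words_def by blast
  have "br (br (f k) (e i)) ?w \<in> ?V"
  proof (cases "i = k")
    case True
    have "br (coroot i) ?w = sc (wt (letter_count (is @ [j])) (coroot i)) ?w"
      using e_words_root_space coroot_in_cartan root_spaceD by blast
    then show ?thesis using True w
      by (auto simp: br_f_e br_linear intro!: span_neg span_scale intro: span_base)
  qed (simp add: br_f_e br_linear span_zero)
  moreover have "br (e i) (br (f k) ?w) \<in> ?V"
  proof (rule br_span[OF _ Cons.IH])
    fix w assume "w \<in> e_words \<gg> \<union> cartan \<gg>"
    then consider (word) "is" j where "w = e_word \<gg> is (e j)" | (cartan) "w \<in> cartan \<gg>"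
      unfolding e_words_def by blast
    then show "br (e i) w \<in> ?V"
    proof cases
      case word
      then have "br (e i) w = e_word \<gg> (i # is) (e j)" by simp
      then show ?thesis unfolding e_words_def by (intro span_base) blast
    next
      case cartan
      then have "br (e i) w = sc (- simple_root \<gg> i w) (e_word \<gg> [] (e i))"
        using br_skew[of w "e i"] rel_he by simp
      also have "\<dots> \<in> ?V" unfolding e_words_def by (intro span_scale span_base) blast
      finally show ?thesis .
    qed
  qed
  ultimately show ?case
    using br_derivation[of "f k" "e i" ?w] by (simp add: span_add)
qed

end

context kac_moody_algebra
begin

interpretation swap: kac_moody_algebra A "chevalley_swap \<gg>"
  by (rule kac_moody_algebra_chevalley_swap)

abbreviation "f_words \<equiv> e_words (chevalley_swap \<gg>)"

text \<open>The span of the brackets of the \<open>e i\<close>, of those of the \<open>f i\<close> and of the Cartan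
  subalgebra is stable under the generators, hence is an ideal containing them.\<close>

lemma triangular_decomposition: "x \<in> span (e_words \<gg> \<union> cartan \<gg> \<union> f_words)"
proof -
  let ?W = "e_words \<gg> \<union> cartan \<gg> \<union> f_words"
  have sub: "span (e_words \<gg> \<union> cartan \<gg>) \<subseteq> span ?W" "span (f_words \<union> cartan \<gg>) \<subseteq> span ?W"
    by (auto intro!: span_mono)
  have cartan_e: "br h w \<in> span (e_words \<gg>)" if h: "h \<in> cartan \<gg>" and w: "w \<in> e_words \<gg>" for h w
  proof -
    obtain "is" j where "w = e_word \<gg> is (e j)" using w unfolding e_words_def by auto
    then have "br h w = sc (wt (letter_count (is @ [j])) h) w"
      using e_words_root_space h root_spaceD by blast
    then show ?thesis using w by (auto intro: span_scale span_base)
  qed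
  have cartan_f: "br h w \<in> span f_words" if h: "h \<in> cartan \<gg>" and w: "w \<in> f_words" for h w
  proof -
    obtain "is" j where "w = e_word (chevalley_swap \<gg>) is (f j)"
      using w unfolding e_words_def by auto
    then have "br h w = sc ((- wt (letter_count (is @ [j]))) h) w"
      using swap.e_words_root_space[of "is" j] h root_spaceD by simp
    then show ?thesis using w by (auto intro: span_scale span_neg span_base)
  qed
  have sub': "span (e_words \<gg>) \<subseteq> span ?W" "span f_words \<subseteq> span ?W"
    by (auto intro!: span_mono)
  have e_step: "br (e i) w \<in> span ?W" if "w \<in> ?W" for i w
    using that
  proof (elim UnE)
    assume "w \<in> e_words \<gg>"
    then obtain "is" j where "br (e i) w = e_word \<gg> (i # is) (e j)" unfolding e_words_def by auto
    then show ?thesis unfolding e_words_def by (intro span_base) blast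
  next
    assume "w \<in> cartan \<gg>"
    then have "br (e i) w = sc (- simple_root \<gg> i w) (e_word \<gg> [] (e i))"
      using br_skew[of w "e i"] rel_he by simp
    also have "\<dots> \<in> span ?W" unfolding e_words_def by (intro span_scale span_base) blast
    finally show ?thesis .
  next
    assume "w \<in> f_words"
    then show ?thesis using swap.br_f_e_word[of i] sub(2) unfolding e_words_def by auto
  qed
  have f_step: "br (f i) w \<in> span ?W" if "w \<in> ?W" for i w
    using that
  proof (elim UnE)
    assume "w \<in> f_words"
    then obtain "is" j where "br (f i) w = e_word (chevalley_swap \<gg>) (i # is) (f j)"
      unfolding e_words_def by auto
    then show ?thesis unfolding e_words_def
      by (intro span_base) (metis (mono_tags, lifting) UnCI chevalley_swap_simps(6) mem_Collect_eq)
  next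
    assume "w \<in> cartan \<gg>"
    then have "br (f i) w = sc (simple_root \<gg> i w) (e_word (chevalley_swap \<gg>) [] (f i))"
      using br_skew[of w "f i"] rel_hf by simp
    also have "\<dots> \<in> span ?W" unfolding e_words_def
      by (intro span_scale span_base) (metis (mono_tags, lifting) UnCI chevalley_swap_simps(6) mem_Collect_eq)
    finally show ?thesis .
  next
    assume "w \<in> e_words \<gg>"
    then show ?thesis using br_f_e_word[of i] sub(1) unfolding e_words_def by auto
  qed
  have h_step: "br h w \<in> span ?W" if "h \<in> cartan \<gg>" "w \<in> ?W" for h w
    using that cartan_e[of h w] cartan_f[of h w] sub' rel_hh[of h w] by (auto simp: span_zero)
  have "br x v \<in> span ?W" if "v \<in> span ?W" for x v
  proof (rule br_invariant_subspace[OF subspace_span _ _ _ that])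
    fix i v assume v: "v \<in> span ?W"
    show "br (e i) v \<in> span ?W" by (rule br_span[OF e_step v])
    show "br (f i) v \<in> span ?W" by (rule br_span[OF f_step v])
  next
    fix h v assume "h \<in> cartan \<gg>" and v: "v \<in> span ?W"
    then show "br h v \<in> span ?W" using br_span[OF h_step v] by blast
  qed
  then have "lie_subalgebra sc br (span ?W)"
    unfolding lie_subalgebra_def by auto
  then show ?thesis
  proof (rule subalgebra_containing_generators)
    show "range e \<subseteq> span ?W"
    proof safe
      fix i
      have "e_word \<gg> [] (e i) \<in> span ?W" unfolding e_words_def by (intro span_base) blast
      then show "e i \<in> span ?W" by simp
    qed
    show "range f \<subseteq> span ?W"
    proof safe
      fix i
      have "e_word (chevalley_swap \<gg>) [] (f i) \<in> f_words"
        unfolding e_words_def by (metis (mono_tags, lifting) chevalley_swap_simps(6) mem_Collect_eq)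
      then show "f i \<in> span ?W" by (auto intro: span_base)
    qed
    show "cartan \<gg> \<subseteq> span ?W" by (auto intro: span_base)
  qed
qed

section \<open>Serre relations and simple root spaces\<close>

text \<open>The ideal generated by a vector of positive weight killed by all \<open>f i\<close> consists of vectors
  of positive weight, so it meets the Cartan subalgebra trivially.\<close>

lemma lowest_vector_zero:
  assumes x: "x \<in> \<R> (wt c)" and c: "\<And>i. c i \<ge> 0" "c \<noteq> 0" and fx: "\<And>k. br (f k) x = 0"
  shows "x = 0"
proof -
  let ?W = "{e_word \<gg> is x |is. True}"
  have word_wt: "e_word \<gg> is x \<in> \<R> (wt (letter_count is + c))" for "is"
    by (rule e_word_root_space[OF x])
  have h_step: "br h w \<in> span ?W" if "h \<in> cartan \<gg>" "w \<in> ?W" for h w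
    using that br_cartan_e_word[OF _ x] by blast
  have e_step: "br (e i) w \<in> span ?W" if w: "w \<in> ?W" for i w
  proof -
    from w obtain "is" where "w = e_word \<gg> is x" by blast
    then have "br (e i) w = e_word \<gg> (i # is) x" by simp
    then show ?thesis by (intro span_base) blast
  qed
  have f_word: "br (f k) (e_word \<gg> is x) \<in> span ?W" for k "is"
  proof (induction "is")
    case Nil
    show ?case using fx by (simp add: span_zero)
  next
    case (Cons i "is")
    let ?w = "e_word \<gg> is x"
    have "br (br (f k) (e i)) ?w \<in> span ?W"
    proof (cases "i = k")
      case True
      then have "br (br (f k) (e i)) ?w = - br (coroot i) ?w" by (simp add: br_f_e br_linear)
      also have "\<dots> \<in> span ?W" by (rule span_neg, rule h_step) (auto intro: coroot_in_cartan)
      finally show ?thesis .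
    qed (simp add: br_f_e br_linear span_zero)
    moreover have "br (e i) (br (f k) ?w) \<in> span ?W"
      by (rule br_span[OF e_step Cons.IH])
    ultimately show ?case
      using br_derivation[of "f k" "e i" ?w] by (simp add: span_add)
  qed
  have "br y v \<in> span ?W" if "v \<in> span ?W" for y v
  proof (rule br_invariant_subspace[OF subspace_span _ _ _ that])
    fix i v assume v: "v \<in> span ?W"
    show "br (e i) v \<in> span ?W" by (rule br_span[OF e_step v])
    show "br (f i) v \<in> span ?W" by (rule br_span[OF _ v]) (use f_word in blast)
  next
    fix h v assume "h \<in> cartan \<gg>" and v: "v \<in> span ?W"
    then show "br h v \<in> span ?W" using br_span[OF h_step v] by blast
  qed
  then have ideal: "lie_ideal sc br (span ?W)"
    unfolding lie_ideal_def by auto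
  have "y = 0" if y: "y \<in> span ?W" "y \<in> cartan \<gg>" for y
  proof -
    have "y \<in> span (?W \<inter> \<R> 0)"
    proof (rule root_space_span[OF _ y(1)])
      show "y \<in> \<R> 0" using y(2) by (rule cartan_in_root_space)
    qed (use dual_cartan_closed(1) word_wt weight_in_dual in blast)+
    moreover have "?W \<inter> \<R> 0 \<subseteq> {0}"
    proof safe
      fix "is" assume "e_word \<gg> is x \<in> \<R> 0"
      moreover have "wt (letter_count is + c) \<noteq> 0"
      proof
        assume "wt (letter_count is + c) = 0"
        then have "letter_count is + c = 0" by (simp add: weight_eq_0_iff)
        then have "letter_count is i + c i = 0" for i by (metis plus_fun_apply zero_fun_apply)
        then have "c i = 0" for i using c(1)[of i] letter_count_nonneg[of "is" i] by (metis add_nonneg_eq_0_iff)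
        then show False using c(2) by (simp add: fun_eq_iff)
      qed
      ultimately show "e_word \<gg> is x = 0"
        using root_space_disjoint[OF _ word_wt _ weight_in_dual, of "is" 0] dual_cartan_closed(1) by metis
    qed
    ultimately show ?thesis by (metis span_mono span_0 span_empty span_insert_0 singletonD subsetD)
  qed
  then have "span ?W \<inter> cartan \<gg> = {0}"
    using span_zero cartan_subspace subspace_0 by blast
  then have "span ?W = {0}" by (rule no_ideals[OF ideal])
  moreover have "e_word \<gg> [] x \<in> span ?W" by (intro span_base) blast
  ultimately show ?thesis by simp
qed

lemma ad_pow_e_word: "ad_pow (e i) n x = e_word \<gg> (replicate n i) x"
  by (induction n) simp_all

lemma br_commuting_ad_pow:
  "br y x = 0 \<Longrightarrow> br y (ad_pow x n z) = ad_pow x n (br y z)"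
  by (induction n) (simp_all add: br_derivation[of y x] br_linear)

text \<open>The vector is killed by all \<open>f k\<close>. For \<open>k = i\<close> the coefficient in the sl(2) computation
  vanishes at exactly this power, because \<open>e j\<close> has weight \<open>A $ i $ j\<close>. Every other \<open>f k\<close>
  commutes with \<open>e i\<close>, and for \<open>k = j\<close> it leaves a power of \<open>br (e i)\<close> applied to a
  coroot.\<close>

lemma serre_relation:
  assumes "i \<noteq> j"
  shows "ad_pow (e i) (Suc (nat (- A $ i $ j))) (e j) = 0"
proof (rule lowest_vector_zero)
  define N where "N = nat (- A $ i $ j)"
  have Aij: "A $ i $ j = - int N"
    using gcm assms unfolding generalized_cartan_matrix_def N_def by auto
  show "ad_pow (e i) (Suc (nat (- A $ i $ j))) (e j)
      \<in> \<R> (wt (letter_count (replicate (Suc (nat (- A $ i $ j))) i) + unit_wt j))"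
    unfolding ad_pow_e_word by (rule e_word_root_space) (simp add: weight_unit_wt e_in_root_space)
  show "0 \<le> (letter_count (replicate (Suc (nat (- A $ i $ j))) i) + unit_wt j) k" for k
    using letter_count_nonneg[of _ k] by (simp add: unit_wt_def)
  have "(letter_count (replicate (Suc (nat (- A $ i $ j))) i) + unit_wt j) j > 0"
    using letter_count_nonneg[of _ j] by (simp add: unit_wt_def add_nonneg_pos)
  then show "letter_count (replicate (Suc (nat (- A $ i $ j))) i) + unit_wt j \<noteq> 0"
    by (metis less_irrefl zero_fun_apply)
  fix k
  show "br (f k) (ad_pow (e i) (Suc (nat (- A $ i $ j))) (e j)) = 0"
    unfolding N_def[symmetric]
  proof (cases "k = i")
    case True
    have "br (f i) (ad_pow (e i) (Suc N) (e j))
        = sc (- (of_nat (Suc N) * (of_int (A $ i $ j) + of_nat N))) (ad_pow (e i) N (e j))"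
    proof (rule br_lowering_raising_power)
      show "br (e i) (f i) = coroot i" by (simp add: rel_ef)
      show "br (coroot i) (e i) = sc 2 (e i)"
        using gcm unfolding generalized_cartan_matrix_def
        by (simp add: rel_he coroot_in_cartan pairing)
      show "br (coroot i) (e j) = sc (of_int (A $ i $ j)) (e j)"
        by (simp add: rel_he coroot_in_cartan pairing)
      show "br (e i) (br (f i) (e j)) = 0" using assms by (simp add: br_f_e br_linear)
    qed
    then show "br (f k) (ad_pow (e i) (Suc N) (e j)) = 0" using True by (simp add: Aij)
  next
    case False
    then have "br (f k) (ad_pow (e i) (Suc N) (e j)) = ad_pow (e i) (Suc N) (br (f k) (e j))"
      by (intro br_commuting_ad_pow) (simp add: br_f_e)
    also have "\<dots> = 0"
    proof (cases "j = k")
      case True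
      have eh: "br (e i) (coroot j) = sc (- of_int (A $ j $ i)) (e i)"
        using br_skew[of "coroot j" "e i"] rel_he[OF coroot_in_cartan] pairing by simp
      show ?thesis
      proof (cases N)
        case 0
        then have "A $ j $ i = 0"
          using Aij gcm unfolding generalized_cartan_matrix_def by auto
        then show ?thesis using True 0 eh by (simp add: br_f_e br_linear)
      next
        case (Suc M)
        have "ad_pow (e i) (Suc (Suc M)) (coroot j) = 0"
          by (simp only: ad_pow_Suc_right eh br_linear alternating scale_zero_right ad_pow_linear)
        then show ?thesis using True Suc by (simp add: br_f_e br_linear ad_pow_linear)
      qed
    qed (simp add: br_f_e ad_pow_linear br_linear)
    finally show "br (f k) (ad_pow (e i) (Suc N) (e j)) = 0" .
  qed
qed

lemma locally_ad_nilpotent_e: "locally_ad_nilpotent (e i)"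
  unfolding locally_ad_nilpotent_def
proof
  fix y
  have h: "ad_pow (e i) 2 h = 0" if "h \<in> cartan \<gg>" for h
  proof -
    have "br (e i) h = - sc (simple_root \<gg> i h) (e i)"
      using br_skew[of h "e i"] rel_he[OF that] by simp
    then show ?thesis by (simp add: numeral_2_eq_2 br_linear alternating)
  qed
  have "y \<in> {y. \<exists>n. ad_pow (e i) n y = 0}"
  proof (rule subalgebra_containing_generators[OF lie_subalgebra_nilpotent])
    show "cartan \<gg> \<subseteq> {y. \<exists>n. ad_pow (e i) n y = 0}" using h by blast
    have "\<exists>n. ad_pow (e i) n (e j) = 0" for j
    proof (cases "i = j")
      case True
      then have "ad_pow (e i) 1 (e j) = 0" by (simp add: alternating)
      then show ?thesis by blast
    qed (use serre_relation in blast)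
    then show "range e \<subseteq> {y. \<exists>n. ad_pow (e i) n y = 0}" by auto
    have "ad_pow (e i) (Suc 2) (f j) = 0" for j
      using h[OF coroot_in_cartan, of i] unfolding ad_pow_Suc_right
      by (cases "i = j") (simp_all add: rel_ef ad_pow_linear)
    then show "range f \<subseteq> {y. \<exists>n. ad_pow (e i) n y = 0}" by blast
  qed
  then show "\<exists>n. ad_pow (e i) n y = 0" by blast
qed

lemma locally_ad_nilpotent_f: "locally_ad_nilpotent (f i)"
  using kac_moody_algebra.locally_ad_nilpotent_e[OF kac_moody_algebra_chevalley_swap] by simp

text \<open>The weight being nonzero, the words in the \<open>e i\<close> and in the \<open>f i\<close> of the triangular
  decomposition suffice.\<close>

lemma root_space_words:
  assumes x: "x \<in> \<R> \<alpha>" and \<alpha>: "\<alpha> \<in> dual_cartan \<gg>" "\<alpha> \<noteq> 0"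
  shows "x \<in> span ((e_words \<gg> \<inter> \<R> \<alpha>) \<union> (f_words \<inter> \<R> \<alpha>))"
proof -
  let ?W = "e_words \<gg> \<union> cartan \<gg> \<union> f_words"
  have "x \<in> span (?W \<inter> \<R> \<alpha>)"
  proof (rule root_space_span[OF _ triangular_decomposition x \<alpha>(1)])
    fix w assume "w \<in> ?W"
    then consider "is" j where "w = e_word \<gg> is (e j)"
      | "w \<in> cartan \<gg>" | "is" j where "w = e_word (chevalley_swap \<gg>) is (f j)"
      unfolding e_words_def by auto
    then show "\<exists>\<nu>\<in>dual_cartan \<gg>. w \<in> \<R> \<nu>"
    proof cases
      case (1 "is" j)
      then show ?thesis using e_words_root_space weight_in_dual by blast
    next
      case 2
      then show ?thesis using cartan_in_root_space dual_cartan_closed(1) by blast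
    next
      case (3 "is" j)
      then have "w \<in> \<R> (- wt (letter_count (is @ [j])))" using swap.e_words_root_space[of "is" j] by simp
      then show ?thesis using weight_in_dual dual_cartan_closed(4) by blast
    qed
  qed
  moreover have "w = 0" if "w \<in> cartan \<gg>" "w \<in> \<R> \<alpha>" for w
    using root_space_disjoint[OF that(2) cartan_in_root_space[OF that(1)]] \<alpha> dual_cartan_closed(1) by blast
  then have "?W \<inter> \<R> \<alpha> \<subseteq> insert 0 ((e_words \<gg> \<inter> \<R> \<alpha>) \<union> (f_words \<inter> \<R> \<alpha>))" by blast
  from span_mono[OF this] have "span (?W \<inter> \<R> \<alpha>) \<subseteq> span ((e_words \<gg> \<inter> \<R> \<alpha>) \<union> (f_words \<inter> \<R> \<alpha>))"
    by (simp only: span_insert_0)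
  ultimately show ?thesis by blast
qed

text \<open>The innermost bracket of the word is \<open>br (e i) (e i)\<close>.\<close>

lemma e_word_letters_zero:
  assumes "\<And>k. k \<noteq> i \<Longrightarrow> letter_count (is @ [j]) k = 0" "is \<noteq> []"
  shows "e_word \<gg> is (e j) = 0"
proof -
  have all: "set (is @ [j]) \<subseteq> {i}"
    using assms(1) letter_count_eq_0_iff by fastforce
  obtain js k where "is = js @ [k]" using assms(2) by (metis rev_exhaust)
  then have "e_word \<gg> is (e j) = e_word \<gg> js (br (e i) (e i))"
    using all by (simp add: e_word_def)
  also have "\<dots> = 0" by (induction js) (simp_all add: alternating br_linear)
  finally show ?thesis .
qed

text \<open>The coordinates of the weight of a nonzero word count its letters. Together with the
  analogue for the \<open>f i\<close> this gives every root a sign and shows that a simple root has a line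
  as root space and \<open>1\<close> and \<open>- 1\<close> as its only multiples that are roots.\<close>

lemma nonzero_e_word_weight:
  assumes "w \<in> e_words \<gg>" "w \<in> \<R> (wt c)" "w \<noteq> 0"
  shows "c \<noteq> 0" "c k \<ge> 0" "(\<And>k. k \<noteq> i \<Longrightarrow> c k = 0) \<Longrightarrow> w = e i \<and> c = unit_wt i"
proof -
  obtain "is" j where w: "w = e_word \<gg> is (e j)" using assms(1) unfolding e_words_def by auto
  have c: "c = letter_count (is @ [j])"
    using root_space_disjoint[OF assms(2) _ weight_in_dual weight_in_dual assms(3)]
      e_words_root_space w weight_inj by metis
  have "c j \<noteq> 0" unfolding c using letter_count_eq_0_iff[of "is @ [j]" j] by simp
  then show "c \<noteq> 0" by (metis zero_fun_apply)
  show "c k \<ge> 0" unfolding c by (rule letter_count_nonneg)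
  assume only: "\<And>k. k \<noteq> i \<Longrightarrow> c k = 0"
  then have "is = []" using e_word_letters_zero[of i "is" j] assms(3) w c by metis
  moreover have "i = j" using only \<open>c j \<noteq> 0\<close> by metis
  ultimately show "w = e i \<and> c = unit_wt i" using w c by simp
qed

lemma nonzero_f_word_weight:
  assumes "w \<in> f_words" "w \<in> \<R> (wt c)" "w \<noteq> 0"
  shows "c \<noteq> 0" "c k \<le> 0" "(\<And>k. k \<noteq> i \<Longrightarrow> c k = 0) \<Longrightarrow> w = f i \<and> c = - unit_wt i"
proof -
  have w: "w \<in> root_space (chevalley_swap \<gg>) (weight (chevalley_swap \<gg>) (- c))"
    using assms(2) by (simp add: weight_uminus)
  note n = kac_moody_algebra.nonzero_e_word_weight[OF kac_moody_algebra_chevalley_swap assms(1) w assms(3)]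
  show "c \<noteq> 0" "c k \<le> 0" using n(1) n(2)[of k] by auto
  assume "\<And>k. k \<noteq> i \<Longrightarrow> c k = 0"
  then have "w = f i" "- c = unit_wt i" using n(3)[of i] by simp_all
  moreover from \<open>- c = unit_wt i\<close> have "c = - unit_wt i" by (metis minus_minus)
  ultimately show "w = f i \<and> c = - unit_wt i" by simp
qed

lemma rootsE:
  assumes "\<alpha> \<in> roots \<gg>"
  obtains c where "\<alpha> = wt c" "c \<noteq> 0" "(\<forall>i. c i \<ge> 0) \<or> (\<forall>i. c i \<le> 0)"
    "\<And>i. (\<And>k. k \<noteq> i \<Longrightarrow> c k = 0) \<Longrightarrow> c = unit_wt i \<or> c = - unit_wt i"
proof -
  have \<alpha>: "\<alpha> \<in> dual_cartan \<gg>" "\<alpha> \<noteq> 0" "\<R> \<alpha> \<noteq> {0}" using assms unfolding roots_def by auto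
  then obtain x where x: "x \<in> \<R> \<alpha>" "x \<noteq> 0" using subspace_0[OF subspace_root_space] by blast
  have "\<exists>w. w \<noteq> 0 \<and> w \<in> \<R> \<alpha> \<and> (w \<in> e_words \<gg> \<or> w \<in> f_words)"
  proof (rule ccontr)
    assume "\<nexists>w. w \<noteq> 0 \<and> w \<in> \<R> \<alpha> \<and> (w \<in> e_words \<gg> \<or> w \<in> f_words)"
    then have "(e_words \<gg> \<inter> \<R> \<alpha>) \<union> (f_words \<inter> \<R> \<alpha>) \<subseteq> {0}" by blast
    from span_mono[OF this] root_space_words[OF x(1) \<alpha>(1,2)] have "x \<in> span {0}" by (rule subsetD)
    then show False using x(2) by simp
  qed
  then obtain w where w: "w \<noteq> 0" "w \<in> \<R> \<alpha>" "w \<in> e_words \<gg> \<or> w \<in> f_words" by blast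
  then obtain c where c: "\<alpha> = wt c"
  proof (elim disjE)
    assume "w \<in> e_words \<gg>"
    then obtain "is" j where "w = e_word \<gg> is (e j)" unfolding e_words_def by auto
    then have "\<alpha> = wt (letter_count (is @ [j]))"
      using root_space_disjoint[OF w(2) _ \<alpha>(1) weight_in_dual w(1)] e_words_root_space by metis
    then show thesis by (rule that)
  next
    assume "w \<in> f_words"
    then obtain "is" j where "w = e_word (chevalley_swap \<gg>) is (f j)" unfolding e_words_def by auto
    then have "w \<in> \<R> (wt (- letter_count (is @ [j])))"
      using swap.e_words_root_space[of "is" j] by (simp add: weight_uminus)
    then have "\<alpha> = wt (- letter_count (is @ [j]))"
      using root_space_disjoint[OF w(2) _ \<alpha>(1) weight_in_dual w(1)] by metis
    then show thesis by (rule that)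
  qed
  show thesis
  proof (rule that[OF c])
    show "c \<noteq> 0" using \<alpha>(2) c weight_eq_0_iff by blast
    show "(\<forall>i. c i \<ge> 0) \<or> (\<forall>i. c i \<le> 0)"
      using w c nonzero_e_word_weight(2) nonzero_f_word_weight(2) by metis
    show "c = unit_wt i \<or> c = - unit_wt i" if "\<And>k. k \<noteq> i \<Longrightarrow> c k = 0" for i
      using w c nonzero_e_word_weight(3)[of w c i] nonzero_f_word_weight(3)[of w c i] that by metis
  qed
qed

lemma root_space_simple: "\<R> (simple_root \<gg> i) = range (\<lambda>c. sc c (e i))"
proof (intro equalityI subsetI)
  fix x assume x: "x \<in> \<R> (simple_root \<gg> i)"
  have "e_words \<gg> \<inter> \<R> (simple_root \<gg> i) \<subseteq> {0, e i}" "f_words \<inter> \<R> (simple_root \<gg> i) \<subseteq> {0}"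
  proof -
    have "\<And>k. k \<noteq> i \<Longrightarrow> unit_wt i k = 0" by (simp add: unit_wt_def)
    moreover have "unit_wt i \<noteq> - unit_wt i"
      by (auto simp: fun_eq_iff unit_wt_def intro!: exI[of _ i])
    ultimately show "e_words \<gg> \<inter> \<R> (simple_root \<gg> i) \<subseteq> {0, e i}"
      "f_words \<inter> \<R> (simple_root \<gg> i) \<subseteq> {0}"
      using nonzero_e_word_weight(3)[of _ "unit_wt i" i] nonzero_f_word_weight(3)[of _ "unit_wt i" i]
      unfolding weight_unit_wt by blast+
  qed
  then have "(e_words \<gg> \<inter> \<R> (simple_root \<gg> i)) \<union> (f_words \<inter> \<R> (simple_root \<gg> i)) \<subseteq> {0, e i}"
    by blast
  moreover have "simple_root \<gg> i \<noteq> 0"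
  proof
    assume "simple_root \<gg> i = 0"
    then have "unit_wt i = 0" using weight_eq_0_iff[of "unit_wt i"] weight_unit_wt[of \<gg> i] by metis
    then show False by (metis unit_wt_def zero_fun_apply zero_neq_one)
  qed
  ultimately have "x \<in> span {0, e i}"
    using root_space_words[OF x root_in_dual] span_mono by blast
  then show "x \<in> range (\<lambda>c. sc c (e i))" by (simp add: span_insert_0 span_singleton)
qed (auto intro: subspace_scale subspace_root_space e_in_root_space)

lemma root_space_neg_simple: "\<R> (- simple_root \<gg> i) = range (\<lambda>c. sc c (f i))"
  using kac_moody_algebra.root_space_simple[OF kac_moody_algebra_chevalley_swap, of i] by simp

end

section \<open>The invariant form and the real roots\<close>

text \<open>The numbers \<open>eps i\<close> come from a standard form and symmetrize \<open>A\<close>; the positive null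
  vector \<open>u\<close> comes from the affine type and makes the symmetrized form positive semidefinite.\<close>

locale affine_kac_moody = kac_moody_algebra A \<gg>
  for A :: "int ^ 'n ^ 'n" and \<gg> :: "('g::ab_group_add, 'n) kac_moody_data" +
  fixes eps u :: "'n \<Rightarrow> real"
  assumes eps_pos: "eps i > 0"
    and symmetrizable: "real_of_int (A $ i $ j) / eps i = real_of_int (A $ j $ i) / eps j"
    and u_pos: "u i > 0"
    and u_kernel: "(\<Sum>j\<in>UNIV. real_of_int (A $ i $ j) * u j) = 0"
begin

text \<open>The value of the standard form on two simple roots. Below, \<open>rform\<close> is its bilinear extension
  to real coordinates, needed for the Cauchy-Schwarz inequality, and \<open>form\<close> the restriction
  to integral ones.\<close>

definition gram :: "'n \<Rightarrow> 'n \<Rightarrow> real" where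
  "gram i j = real_of_int (A $ i $ j) / eps i"

definition rform :: "('n \<Rightarrow> real) \<Rightarrow> ('n \<Rightarrow> real) \<Rightarrow> real" where
  "rform x y = (\<Sum>i\<in>UNIV. \<Sum>j\<in>UNIV. x i * y j * gram i j)"

lemma gram_sym: "gram i j = gram j i"
  unfolding gram_def by (rule symmetrizable)

lemma rform_sym: "rform x y = rform y x"
proof -
  have "rform x y = (\<Sum>j\<in>UNIV. \<Sum>i\<in>UNIV. x i * y j * gram i j)"
    unfolding rform_def by (rule sum.swap)
  also have "\<dots> = rform y x"
    unfolding rform_def by (intro sum.cong HOL.refl) (simp add: gram_sym mult.commute)
  finally show ?thesis .
qed

lemma rform_combination:
  "rform (\<lambda>i. s * x i + t * y i) z = s * rform x z + t * rform y z"
  "rform z (\<lambda>i. s * x i + t * y i) = s * rform z x + t * rform z y"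
proof -
  show 1: "rform (\<lambda>i. s * x i + t * y i) z = s * rform x z + t * rform y z" for z
    by (simp add: rform_def sum_distrib_left sum.distrib[symmetric] algebra_simps)
  show "rform z (\<lambda>i. s * x i + t * y i) = s * rform z x + t * rform z y"
    using 1[of z] by (simp add: rform_sym[of z])
qed

text \<open>The Gram matrix annihilates the positive vector \<open>u\<close> and is nonpositive off the diagonal,
  so the form is a sum of squares of differences of the \<open>x i / u i\<close> with nonnegative
  coefficients.\<close>

lemma rform_nonneg: "rform x x \<ge> 0"
proof -
  have row: "(\<Sum>j\<in>UNIV. gram i j * u j) = 0" for i
  proof -
    have "(\<Sum>j\<in>UNIV. gram i j * u j) = (\<Sum>j\<in>UNIV. real_of_int (A $ i $ j) * u j) / eps i"
      by (simp add: gram_def sum_divide_distrib)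
    then show ?thesis by (simp add: u_kernel)
  qed
  define S where "S = (\<Sum>i\<in>UNIV. \<Sum>j\<in>UNIV. gram i j * u i * u j * (x i / u i - x j / u j)\<^sup>2)"
  have expand: "gram i j * u i * u j * (x i / u i - x j / u j)\<^sup>2
      = (x i)\<^sup>2 / u i * (gram i j * u j) + (x j)\<^sup>2 / u j * (gram j i * u i) - 2 * (x i * x j * gram i j)"
    for i j
    using u_pos[of i] u_pos[of j] gram_sym[of i j] by (simp add: field_simps power2_eq_square)
  have 1: "(\<Sum>i\<in>UNIV. \<Sum>j\<in>UNIV. (x i)\<^sup>2 / u i * (gram i j * u j)) = 0"
    by (simp only: sum_distrib_left[symmetric] row mult_zero_right sum.neutral_const)
  have 2: "(\<Sum>i\<in>UNIV. \<Sum>j\<in>UNIV. (x j)\<^sup>2 / u j * (gram j i * u i)) = 0"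
    by (subst sum.swap) (rule 1)
  have "S = - 2 * rform x x"
    unfolding S_def expand sum_subtractf sum.distrib 1 2 rform_def
    by (simp add: sum_distrib_left sum_negf)
  moreover have "S \<le> 0"
    unfolding S_def
  proof (intro sum_nonpos)
    fix i j
    show "gram i j * u i * u j * (x i / u i - x j / u j)\<^sup>2 \<le> 0"
    proof (cases "i = j")
      case False
      then have "gram i j \<le> 0"
        using gcm eps_pos[of i] unfolding generalized_cartan_matrix_def gram_def
        by (simp add: divide_nonpos_pos)
      then show ?thesis
        using u_pos[of i] u_pos[of j]
        by (intro mult_nonpos_nonneg) (auto intro!: mult_nonpos_nonneg)
    qed simp
  qed
  ultimately show ?thesis by simp
qed

lemma rform_Cauchy_Schwarz: "(rform x y)\<^sup>2 \<le> rform x x * rform y y"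
proof -
  define p q r where "p = rform x x" and "q = rform x y" and "r = rform y y"
  have expand: "s * s * p + 2 * s * t * q + t * t * r \<ge> 0" for s t
    using rform_nonneg[of "\<lambda>i. s * x i + t * y i"]
    by (simp add: rform_combination rform_sym[of y x] p_def q_def r_def algebra_simps)
  have "q\<^sup>2 \<le> p * r"
  proof (cases "r = 0")
    case False
    then have "r > 0" using rform_nonneg[of y] by (simp add: r_def)
    have "r * (p * r - q\<^sup>2) \<ge> 0"
      using expand[of r "- q"] by (simp add: algebra_simps power2_eq_square)
    then show ?thesis using \<open>r > 0\<close> by (simp add: zero_le_mult_iff)
  next
    case True
    have "q = 0"
    proof (rule ccontr)
      assume "q \<noteq> 0"
      \<comment> \<open>with \<open>r = 0\<close> the quadratic function below is affine in \<open>t\<close>; this \<open>t\<close> gives it the value \<open>- 1\<close>\<close>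
      have "p + 2 * (- (p + 1) / (2 * q)) * q \<ge> 0"
        using expand[of 1 "- (p + 1) / (2 * q)"] True by simp
      moreover have "2 * (- (p + 1) / (2 * q)) * q = - (p + 1)"
        using \<open>q \<noteq> 0\<close> by (simp add: field_simps)
      ultimately show False by linarith
    qed
    then show ?thesis using True by simp
  qed
  then show ?thesis by (simp add: p_def q_def r_def)
qed

definition form :: "('n \<Rightarrow> int) \<Rightarrow> ('n \<Rightarrow> int) \<Rightarrow> real" where
  "form c d = rform (\<lambda>i. of_int (c i)) (\<lambda>i. of_int (d i))"

lemma form_sym: "form c d = form d c"
  unfolding form_def by (rule rform_sym)

lemma form_nonneg: "form c c \<ge> 0"
  unfolding form_def by (rule rform_nonneg)

lemma form_combination:
  assumes "\<And>i. of_int (d i) = s * of_int (a i) + t * of_int (b i)"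
  shows "form d c = s * form a c + t * form b c" "form c d = s * form c a + t * form c b"
  unfolding form_def assms by (rule rform_combination)+

lemma form_diff: "form (a - b) c = form a c - form b c" "form c (a - b) = form c a - form c b"
  using form_combination[of "a - b" 1 a "-1" b] by simp_all

lemma form_uminus: "form (- a) c = - form a c" "form c (- a) = - form c a"
  using form_combination[of "- a" "-1" a 0 a] by simp_all

lemma form_isotropic:
  assumes "form c c = 0"
  shows "form c d = 0"
  using rform_Cauchy_Schwarz[of "\<lambda>i. of_int (c i)" "\<lambda>i. of_int (d i)"] assms by (simp add: form_def)

text \<open>The value of the functional \<open>wt c\<close> on the coroot \<open>i\<close>, as an integer.\<close>

definition pair :: "'n \<Rightarrow> ('n \<Rightarrow> int) \<Rightarrow> int" where
  "pair i c = (\<Sum>j\<in>UNIV. A $ i $ j * c j)"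

lemma weight_coroot: "wt c (coroot i) = of_int (pair i c)"
  by (simp add: weight_def pair_def pairing mult.commute)

lemma sum_unit_wt:
  fixes i :: 'n
  shows "(\<Sum>j\<in>UNIV. of_int (unit_wt i j) * z j) = (z i :: 'a :: comm_ring_1)"
proof -
  have "(\<Sum>j\<in>UNIV. of_int (unit_wt i j) * z j) = (\<Sum>j\<in>UNIV. if j = i then z j else 0)"
    by (intro sum.cong) (auto simp: unit_wt_def)
  then show ?thesis by simp
qed

lemma form_unit_wt: "form (unit_wt i) c = pair i c / eps i"
proof -
  have "form (unit_wt i) c = (\<Sum>k\<in>UNIV. of_int (unit_wt i k) * (\<Sum>j\<in>UNIV. of_int (c j) * gram k j))"
    by (simp add: form_def rform_def sum_distrib_left mult.assoc)
  also have "\<dots> = (\<Sum>j\<in>UNIV. of_int (c j) * gram i j)" by (rule sum_unit_wt)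
  also have "\<dots> = pair i c / eps i"
    by (simp add: pair_def gram_def sum_divide_distrib mult.commute)
  finally show ?thesis .
qed

lemma form_eq_sum_pair: "form c d = (\<Sum>i\<in>UNIV. of_int (c i) * (pair i d / eps i))"
  unfolding form_def rform_def
  by (intro sum.cong HOL.refl)
    (simp add: pair_def gram_def sum_distrib_left sum_divide_distrib algebra_simps)

lemma pair_unit_wt: "pair i (unit_wt i) = 2"
  using gcm sum_unit_wt[of i "\<lambda>j. A $ i $ j"]
  unfolding generalized_cartan_matrix_def pair_def by (simp add: mult.commute)

lemma form_unit_wt_self: "form (unit_wt i) (unit_wt i) = 2 / eps i"
  by (simp add: form_unit_wt pair_unit_wt)

definition refl_wt :: "'n \<Rightarrow> ('n \<Rightarrow> int) \<Rightarrow> 'n \<Rightarrow> int" where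
  "refl_wt i c = (\<lambda>j. c j - pair i c * unit_wt i j)"

lemma pair_refl_wt: "pair i (refl_wt i c) = - pair i c"
proof -
  have "pair i (refl_wt i c) = pair i c - pair i c * pair i (unit_wt i)"
    by (simp add: pair_def refl_wt_def sum_subtractf sum_distrib_left algebra_simps)
  then show ?thesis by (simp add: pair_unit_wt)
qed

lemma refl_wt_refl_wt: "refl_wt i (refl_wt i c) = c"
  using pair_refl_wt[of i c] by (simp add: refl_wt_def[of i "refl_wt i c"]) (simp add: refl_wt_def)

lemma refl_wt_zero: "refl_wt i 0 = 0"
  by (simp add: refl_wt_def pair_def fun_eq_iff)

lemma refl_wt_uminus: "refl_wt i (- c) = - refl_wt i c"
  by (simp add: refl_wt_def pair_def fun_eq_iff sum_negf)

lemma form_refl_wt: "form (refl_wt i c) (refl_wt i d) = form c d"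
proof -
  have comb: "form (refl_wt i c) x = 1 * form c x + (- pair i c) * form (unit_wt i) x"
    "form x (refl_wt i c) = 1 * form x c + (- pair i c) * form x (unit_wt i)" for c x
    by (rule form_combination; simp add: refl_wt_def)+
  have unit: "form x (unit_wt i) = pair i x / eps i" for x
    by (simp add: form_sym[of x] form_unit_wt)
  have "form (refl_wt i c) (refl_wt i d) = form c d - pair i d * form c (unit_wt i)
      - pair i c * (form (unit_wt i) d - pair i d * form (unit_wt i) (unit_wt i))"
    unfolding comb(1)[of c "refl_wt i d"] comb(2)[of c d] comb(2)[of "unit_wt i" d] by simp
  then show ?thesis
    unfolding unit form_unit_wt_self form_unit_wt using eps_pos[of i] by (simp add: field_simps pair_unit_wt)
qed

lemma weight_refl_wt: "wt (refl_wt i c) h = wt c h - of_int (pair i c) * simple_root \<gg> i h"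
proof -
  have "wt (refl_wt i c) h = wt c h - of_int (pair i c) * wt (unit_wt i) h"
    by (simp add: weight_def refl_wt_def sum_subtractf sum_distrib_left algebra_simps)
  then show ?thesis by (simp add: weight_unit_wt)
qed

lemma simple_reflection_weight: "simple_reflection \<gg> i (wt c) = wt (refl_wt i c)"
  by (simp add: simple_reflection_def fun_eq_iff weight_coroot weight_refl_wt)

text \<open>The automorphism acts on the Cartan subalgebra by the reflection \<open>s\<close>, which is an
  involution, so it carries eigenvectors for \<open>\<beta>\<close> to eigenvectors for the composition of
  \<open>\<beta>\<close> with \<open>s\<close>. As an equivalence the statement says that the root space of \<open>\<beta>\<close> is mapped
  onto the other one.\<close>

lemma sl2_reflection_root_space:
  assumes t: "sl2_triple x y h" and xy: "x \<in> \<R> \<alpha>" "y \<in> \<R> (- \<alpha>)"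
    and h: "h \<in> cartan \<gg>" "\<alpha> h = 2" and \<alpha>: "\<alpha> \<in> dual_cartan \<gg>" and \<beta>: "\<beta> \<in> dual_cartan \<gg>"
  shows "sl2_reflection x y z \<in> \<R> (\<lambda>k. \<beta> k - \<beta> h * \<alpha> k) \<longleftrightarrow> z \<in> \<R> \<beta>"
proof -
  define \<tau> where "\<tau> = sl2_reflection x y"
  have aut: "lie_automorphism \<tau>"
    unfolding \<tau>_def by (rule lie_automorphism_sl2_reflection[OF t])
  then have inj: "\<tau> v = \<tau> w \<longleftrightarrow> v = w" and hom: "\<tau> (br v w) = br (\<tau> v) (\<tau> w)"
    and scal: "\<tau> (sc c v) = sc c (\<tau> v)" for v w c
    unfolding lie_automorphism_def by (auto simp: bij_def inj_eq)
  define s where "s k = k - sc (\<alpha> k) h" for k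
  have \<tau>k: "\<tau> k = s k" if "k \<in> cartan \<gg>" for k
    unfolding \<tau>_def s_def
    by (rule sl2_reflection_toral[OF t]) (use xy that root_spaceD in auto)
  have s_cartan: "s k \<in> cartan \<gg>" if "k \<in> cartan \<gg>" for k
    unfolding s_def by (intro subspace_diff subspace_scale cartan_subspace that h(1))
  have lin: "\<phi> (s k) = \<phi> k - \<alpha> k * \<phi> h" if "k \<in> cartan \<gg>" "\<phi> \<in> dual_cartan \<gg>" for \<phi> k
  proof -
    have "\<phi> (k + sc (- \<alpha> k) h) = \<phi> k + \<phi> (sc (- \<alpha> k) h)"
      by (intro dual_cartanD(1)[OF that(2)] that subspace_scale[OF cartan_subspace] h(1))
    also have "k + sc (- \<alpha> k) h = s k" by (simp add: s_def)
    also have "\<phi> (sc (- \<alpha> k) h) = - \<alpha> k * \<phi> h" by (rule dual_cartanD(2)[OF that(2) h(1)])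
    finally show ?thesis by simp
  qed
  have ss: "s (s k) = k" if "k \<in> cartan \<gg>" for k
  proof -
    have "s (s k) = k - sc (\<alpha> k) h - sc (\<alpha> k - \<alpha> k * 2) h"
      using lin[OF that \<alpha>] h(2) by (simp add: s_def)
    also have "sc (\<alpha> k - \<alpha> k * 2) h = - sc (\<alpha> k) h"
      by (simp flip: scale_minus_left)
    finally show ?thesis by simp
  qed
  have "\<tau> z \<in> \<R> (\<lambda>k. \<beta> k - \<beta> h * \<alpha> k)
      \<longleftrightarrow> (\<forall>k\<in>cartan \<gg>. br k (\<tau> z) = sc (\<beta> (s k)) (\<tau> z))"
    unfolding root_space_def using lin[OF _ \<beta>] by (simp add: mult.commute)
  also have "\<dots> \<longleftrightarrow> (\<forall>k\<in>cartan \<gg>. br (s k) (\<tau> z) = sc (\<beta> k) (\<tau> z))"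
    using ss s_cartan by metis
  also have "\<dots> \<longleftrightarrow> (\<forall>k\<in>cartan \<gg>. \<tau> (br k z) = \<tau> (sc (\<beta> k) z))"
    by (simp add: hom scal \<tau>k)
  also have "\<dots> \<longleftrightarrow> z \<in> \<R> \<beta>" by (simp add: inj root_space_def)
  finally show ?thesis by (simp only: \<tau>_def)
qed

text \<open>The properties of a simple root that the reflection automorphisms carry over to all real
  roots: the root spaces of the root and of its negative are lines, spanned by the outer elements
  of a triple whose middle element is the coroot.\<close>

definition root_triple :: "('n \<Rightarrow> int) \<Rightarrow> 'g \<Rightarrow> 'g \<Rightarrow> 'g \<Rightarrow> bool" where
  "root_triple a x y h \<longleftrightarrow> sl2_triple x y h \<and> h \<in> cartan \<gg> \<and>
     \<R> (wt a) = range (\<lambda>c. sc c x) \<and> \<R> (wt (- a)) = range (\<lambda>c. sc c y) \<and>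
     (\<forall>c. wt c h = of_real (2 * form c a / form a a)) \<and> (\<exists>i. form a a = 2 / eps i)"

lemma root_triple_simple: "root_triple (unit_wt i) (e i) (f i) (coroot i)"
proof -
  have "simple_root \<gg> i (coroot i) = 2"
    using gcm pairing[of i i] unfolding generalized_cartan_matrix_def by simp
  then have "sl2_triple (e i) (f i) (coroot i)"
    unfolding sl2_triple_def
    using rel_ef[of i i] rel_he[OF coroot_in_cartan[of i], of i] rel_hf[OF coroot_in_cartan[of i], of i]
    by (simp add: locally_ad_nilpotent_e locally_ad_nilpotent_f)
  moreover have "wt c (coroot i) = of_real (2 * form c (unit_wt i) / form (unit_wt i) (unit_wt i))" for c
    using eps_pos[of i] by (simp add: weight_coroot form_unit_wt_self form_sym[of c] form_unit_wt pair_unit_wt)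
  ultimately show ?thesis
    unfolding root_triple_def
    by (auto simp: coroot_in_cartan weight_unit_wt weight_uminus root_space_simple
        root_space_neg_simple form_unit_wt_self)
qed

lemma root_triple_refl_wt:
  assumes "root_triple a x y h"
  shows "\<exists>x y h. root_triple (refl_wt i a) x y h"
proof -
  define \<tau> where "\<tau> = sl2_reflection (e i) (f i)"
  have t: "sl2_triple (e i) (f i) (coroot i)"
    using root_triple_simple unfolding root_triple_def by blast
  have two: "simple_root \<gg> i (coroot i) = 2"
    using weight_coroot[of "unit_wt i" i] by (simp add: weight_unit_wt pair_unit_wt)
  have aut: "lie_automorphism \<tau>"
    unfolding \<tau>_def by (rule lie_automorphism_sl2_reflection[OF t])
  then have surj: "\<exists>v. w = \<tau> v" and hom: "\<tau> (br v w) = br (\<tau> v) (\<tau> w)"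
    and scal: "\<tau> (sc c v) = sc c (\<tau> v)" for v w c
    unfolding lie_automorphism_def by (auto simp: bij_def surj_def)
  have a: "sl2_triple x y h" "h \<in> cartan \<gg>" "\<R> (wt a) = range (\<lambda>c. sc c x)"
    "\<R> (wt (- a)) = range (\<lambda>c. sc c y)" "\<And>c. wt c h = of_real (2 * form c a / form a a)"
    "\<exists>i. form a a = 2 / eps i"
    using assms unfolding root_triple_def by auto
  have \<R>_refl: "\<tau> z \<in> \<R> (wt (refl_wt i b)) \<longleftrightarrow> z \<in> \<R> (wt b)" for z b
  proof -
    have "wt (refl_wt i b) = (\<lambda>k. wt b k - wt b (coroot i) * simple_root \<gg> i k)"
      by (simp add: fun_eq_iff weight_refl_wt weight_coroot)
    then show ?thesis
      unfolding \<tau>_def using sl2_reflection_root_space[OF t e_in_root_space f_in_root_space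
          coroot_in_cartan two root_in_dual weight_in_dual[of b]] by simp
  qed
  have line: "\<R> (wt (refl_wt i b)) = range (\<lambda>c. sc c (\<tau> z))" if "\<R> (wt b) = range (\<lambda>c. sc c z)" for z b
  proof (intro equalityI subsetI)
    fix w assume w: "w \<in> \<R> (wt (refl_wt i b))"
    obtain v where v: "w = \<tau> v" using surj by blast
    then have "v \<in> range (\<lambda>c. sc c z)" using \<R>_refl w that by blast
    then show "w \<in> range (\<lambda>c. sc c (\<tau> z))" using v scal by auto
  next
    fix w assume "w \<in> range (\<lambda>c. sc c (\<tau> z))"
    then obtain c where "w = \<tau> (sc c z)" using scal by auto
    then show "w \<in> \<R> (wt (refl_wt i b))" using \<R>_refl that by blast
  qed
  have "\<tau> h = h - sc (simple_root \<gg> i h) (coroot i)"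
    unfolding \<tau>_def
    by (rule sl2_reflection_toral[OF t]) (use a(2) rel_he rel_hf in auto)
  then have \<tau>h: "\<tau> h = h + sc (- simple_root \<gg> i h) (coroot i)" by simp
  have "root_triple (refl_wt i a) (\<tau> x) (\<tau> y) (\<tau> h)"
    unfolding root_triple_def
  proof (intro conjI allI)
    show "sl2_triple (\<tau> x) (\<tau> y) (\<tau> h)"
      using a(1) lie_automorphism_nilpotent[OF aut] unfolding sl2_triple_def
      by (simp flip: hom scal)
    show "\<tau> h \<in> cartan \<gg>"
      unfolding \<tau>h by (intro subspace_add subspace_scale cartan_subspace a(2) coroot_in_cartan)
    show "\<R> (wt (refl_wt i a)) = range (\<lambda>c. sc c (\<tau> x))" by (rule line[OF a(3)])
    show "\<R> (wt (- refl_wt i a)) = range (\<lambda>c. sc c (\<tau> y))"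
      using line[OF a(4)] by (simp add: refl_wt_uminus)
    show "\<exists>j. form (refl_wt i a) (refl_wt i a) = 2 / eps j" using a(6) by (simp add: form_refl_wt)
    fix c
    have "wt c (\<tau> h) = wt c h + wt c (sc (- simple_root \<gg> i h) (coroot i))"
      unfolding \<tau>h
      by (intro dual_cartanD(1)[OF weight_in_dual] a(2) subspace_scale[OF cartan_subspace] coroot_in_cartan)
    also have "wt c (sc (- simple_root \<gg> i h) (coroot i)) = - simple_root \<gg> i h * wt c (coroot i)"
      by (rule dual_cartanD(2)[OF weight_in_dual coroot_in_cartan])
    also have "wt c h + - simple_root \<gg> i h * wt c (coroot i) = wt (refl_wt i c) h"
      by (simp add: weight_refl_wt weight_coroot mult.commute)
    also have "\<dots> = of_real (2 * form (refl_wt i c) a / form a a)" by (rule a(5))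
    also have "form (refl_wt i c) a = form c (refl_wt i a)"
      using form_refl_wt[of i c "refl_wt i a"] by (simp add: refl_wt_refl_wt)
    finally show "wt c (\<tau> h) = of_real (2 * form c (refl_wt i a) / form (refl_wt i a) (refl_wt i a))"
      by (simp add: form_refl_wt)
  qed
  then show ?thesis by blast
qed

text \<open>Read backwards along a product of simple reflections: if \<open>w\<close> takes a weight to a simple
  root, the triple of the simple root is transported back to that weight.\<close>

lemma weyl_group_root_triple:
  assumes "w \<in> weyl_group \<gg>"
  shows "\<exists>d. w (wt c) = wt d \<and> ((\<exists>x y h. root_triple d x y h) \<longrightarrow> (\<exists>x y h. root_triple c x y h))"
  using assms
proof induction
  case (refl w i)
  then obtain d where d: "w (wt c) = wt d"
    "(\<exists>x y h. root_triple d x y h) \<longrightarrow> (\<exists>x y h. root_triple c x y h)" by blast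
  have "(\<exists>x y h. root_triple (refl_wt i d) x y h) \<longrightarrow> (\<exists>x y h. root_triple d x y h)"
    using root_triple_refl_wt[of "refl_wt i d" _ _ _ i] by (auto simp: refl_wt_refl_wt)
  then show ?case using d by (auto simp: simple_reflection_weight)
qed auto

lemma real_root_triple:
  assumes "wt a \<in> real_roots \<gg>"
  obtains x y h where "root_triple a x y h"
proof -
  obtain w i where w: "w \<in> weyl_group \<gg>" "w (wt a) = wt (unit_wt i)"
    using assms unfolding real_roots_def by (auto simp: weight_unit_wt)
  then show thesis
    using weyl_group_root_triple[OF w(1), of a] root_triple_simple that weight_inj by metis
qed

lemma root_triple_nonzero:
  assumes "root_triple a x y h"
  shows "form a a > 0" "x \<noteq> 0" "y \<noteq> 0" "a \<noteq> 0"
proof -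
  show pos: "form a a > 0" using assms eps_pos unfolding root_triple_def by auto
  have "wt a h = of_real (2 * form a a / form a a)" using assms unfolding root_triple_def by blast
  then have two: "wt a h = 2" using pos by simp
  have "wt a 0 = 0" using dual_cartanD(2)[OF weight_in_dual coroot_in_cartan, of a 0] by simp
  then have "h \<noteq> 0" using two by auto
  moreover have "br x y = h" using assms unfolding root_triple_def sl2_triple_def by blast
  ultimately show "x \<noteq> 0" "y \<noteq> 0" by (auto simp: br_linear)
  show "a \<noteq> 0" using two by (auto simp: weight_zero)
qed

lemma weyl_group_comp_reflection:
  "w \<in> weyl_group \<gg> \<Longrightarrow> w \<circ> simple_reflection \<gg> i \<in> weyl_group \<gg>"
proof (induction rule: weyl_group.induct)
  case one
  show ?case using weyl_group.refl[OF weyl_group.one, of \<gg> i] by simp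
next
  case (refl w j)
  show ?case using weyl_group.refl[OF refl.IH, of j] by (simp only: comp_assoc)
qed

lemma weight_in_roots_iff: "wt c \<in> roots \<gg> \<longleftrightarrow> c \<noteq> 0 \<and> (\<exists>x\<in>\<R> (wt c). x \<noteq> 0)"
  using subspace_0[OF subspace_root_space[of "wt c"]]
  unfolding roots_def by (auto simp: weight_in_dual weight_eq_0_iff)

lemma refl_wt_roots:
  assumes "wt c \<in> roots \<gg>"
  shows "wt (refl_wt i c) \<in> roots \<gg>"
proof -
  have t: "sl2_triple (e i) (f i) (coroot i)"
    using root_triple_simple unfolding root_triple_def by blast
  have two: "simple_root \<gg> i (coroot i) = 2"
    using weight_coroot[of "unit_wt i" i] by (simp add: weight_unit_wt pair_unit_wt)
  obtain x where x: "x \<in> \<R> (wt c)" "x \<noteq> 0" and c: "c \<noteq> 0"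
    using assms unfolding weight_in_roots_iff by blast
  have "wt (refl_wt i c) = (\<lambda>k. wt c k - wt c (coroot i) * simple_root \<gg> i k)"
    by (simp add: fun_eq_iff weight_refl_wt weight_coroot)
  then have "sl2_reflection (e i) (f i) x \<in> \<R> (wt (refl_wt i c))"
    using sl2_reflection_root_space[OF t e_in_root_space f_in_root_space
          coroot_in_cartan two root_in_dual weight_in_dual[of c]] x(1) by simp
  moreover have "sl2_reflection (e i) (f i) x \<noteq> 0"
    using lie_automorphism_eq_zero_iff[OF lie_automorphism_sl2_reflection[OF t]] x(2) by simp
  moreover have "refl_wt i c \<noteq> 0"
    using refl_wt_refl_wt[of i c] c by (metis refl_wt_zero)
  ultimately show ?thesis unfolding weight_in_roots_iff by blast
qed

definition ht :: "('n \<Rightarrow> int) \<Rightarrow> int" where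
  "ht c = (\<Sum>i\<in>UNIV. c i)"

lemma ht_linear: "ht (a + b) = ht a + ht b" "ht (a - b) = ht a - ht b" "ht (- a) = - ht a"
  by (simp_all add: ht_def sum.distrib sum_subtractf sum_negf)

lemma ht_refl_wt: "ht (refl_wt i c) = ht c - pair i c"
proof -
  have "ht (refl_wt i c) = ht c - pair i c * ht (unit_wt i)"
    by (simp add: ht_def refl_wt_def sum_subtractf sum_distrib_left)
  moreover have "ht (unit_wt i) = 1" unfolding ht_def unit_wt_def by simp
  ultimately show ?thesis by simp
qed

lemma ht_pos: "(\<And>i. c i \<ge> 0) \<Longrightarrow> c \<noteq> 0 \<Longrightarrow> ht c > 0"
proof -
  assume c: "\<And>i. c i \<ge> 0" "c \<noteq> 0"
  then obtain i where "c i \<noteq> 0" by (auto simp: fun_eq_iff)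
  then have "c i > 0" using c(1)[of i] by simp
  then show "ht c > 0" unfolding ht_def using c(1) by (intro sum_pos2[of UNIV i]) auto
qed

lemma roots_weightE:
  assumes "wt c \<in> roots \<gg>"
  shows "c \<noteq> 0" "ht c > 0 \<Longrightarrow> c i \<ge> 0" "ht c < 0 \<Longrightarrow> c i \<le> 0" "ht c \<noteq> 0"
    "(\<And>k. k \<noteq> i \<Longrightarrow> c k = 0) \<Longrightarrow> c = unit_wt i \<or> c = - unit_wt i"
proof -
  obtain d where "wt c = wt d" "d \<noteq> 0" and sign: "(\<forall>i. d i \<ge> 0) \<or> (\<forall>i. d i \<le> 0)"
    and single: "\<And>i. (\<And>k. k \<noteq> i \<Longrightarrow> d k = 0) \<Longrightarrow> d = unit_wt i \<or> d = - unit_wt i"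
    using rootsE[OF assms] by metis
  then have d: "d = c" "c \<noteq> 0" using weight_inj by auto
  then show "c \<noteq> 0" by simp
  have "ht c > 0 \<and> (\<forall>i. c i \<ge> 0) \<or> ht c < 0 \<and> (\<forall>i. c i \<le> 0)"
    using sign ht_pos[of c] ht_pos[of "- c"] d by (auto simp: ht_linear)
  then show "ht c > 0 \<Longrightarrow> c i \<ge> 0" "ht c < 0 \<Longrightarrow> c i \<le> 0" "ht c \<noteq> 0" by auto
  show "(\<And>k. k \<noteq> i \<Longrightarrow> c k = 0) \<Longrightarrow> c = unit_wt i \<or> c = - unit_wt i"
    using single d by blast
qed

lemma real_rootsI:
  "\<alpha> \<in> roots \<gg> \<Longrightarrow> w \<in> weyl_group \<gg> \<Longrightarrow> w \<alpha> \<in> range (simple_root \<gg>) \<Longrightarrow> \<alpha> \<in> real_roots \<gg>"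
  unfolding real_roots_def by blast

lemma real_roots_if_refl_wt:
  assumes "wt c \<in> roots \<gg>" "wt (refl_wt i c) \<in> real_roots \<gg>"
  shows "wt c \<in> real_roots \<gg>"
proof -
  obtain w where w: "w \<in> weyl_group \<gg>" "w (wt (refl_wt i c)) \<in> range (simple_root \<gg>)"
    using assms(2) unfolding real_roots_def by blast
  have "(w \<circ> simple_reflection \<gg> i) (wt c) \<in> range (simple_root \<gg>)"
    using w(2) by (simp add: simple_reflection_weight)
  then show ?thesis by (rule real_rootsI[OF assms(1) weyl_group_comp_reflection[OF w(1)]])
qed

text \<open>A root of positive norm has positive pairing, up to its own sign, with a simple root in its
  support. The corresponding reflection brings it closer to zero. It cannot change its sign, because
  it alters only one coordinate, unless the root is plus or minus a simple root. The form being
  semidefinite, the roots that are not real are therefore isotropic.\<close>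

lemma real_root_if_positive_norm:
  assumes "wt c \<in> roots \<gg>" "form c c > 0"
  shows "wt c \<in> real_roots \<gg>"
  using assms
proof (induction "nat \<bar>ht c\<bar>" arbitrary: c rule: less_induct)
  case less
  have "\<exists>i. of_int (c i) * (pair i c / eps i) > 0"
  proof (rule ccontr)
    assume "\<nexists>i. of_int (c i) * (pair i c / eps i) > 0"
    then have "form c c \<le> 0" unfolding form_eq_sum_pair by (intro sum_nonpos) (auto simp: not_less)
    then show False using less.prems(2) by simp
  qed
  then obtain i where "real_of_int (c i) * (pair i c / eps i) > 0" by blast
  then have "real_of_int (c i) * real_of_int (pair i c) > 0"
    using eps_pos[of i] by (simp add: zero_less_divide_iff)
  then have "c i * pair i c > 0" by (simp flip: of_int_mult)
  then have i: "c i > 0 \<and> pair i c > 0 \<or> c i < 0 \<and> pair i c < 0"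
    by (simp add: zero_less_mult_iff)
  show ?case
  proof (cases "\<forall>k. k \<noteq> i \<longrightarrow> c k = 0")
    case True
    then have "c = unit_wt i \<or> c = - unit_wt i" using roots_weightE(5)[OF less.prems(1)] by blast
    then show ?thesis
    proof
      assume c: "c = unit_wt i"
      then have "id (wt c) \<in> range (simple_root \<gg>)" by (simp add: weight_unit_wt)
      then show ?thesis by (rule real_rootsI[OF less.prems(1) weyl_group.one])
    next
      assume c: "c = - unit_wt i"
      have "refl_wt i (unit_wt i) = - unit_wt i"
        by (simp add: refl_wt_def pair_unit_wt fun_eq_iff)
      then have "refl_wt i c = unit_wt i"
        unfolding c by (metis refl_wt_refl_wt)
      then have "(simple_reflection \<gg> i \<circ> id) (wt c) \<in> range (simple_root \<gg>)"
        by (simp add: simple_reflection_weight weight_unit_wt)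
      then show ?thesis
        by (rule real_rootsI[OF less.prems(1) weyl_group.refl[OF weyl_group.one]])
    qed
  next
    case False
    then obtain k where k: "k \<noteq> i" "c k \<noteq> 0" by blast
    have root: "wt (refl_wt i c) \<in> roots \<gg>" by (rule refl_wt_roots[OF less.prems(1)])
    have same: "refl_wt i c k = c k" using k by (simp add: refl_wt_def unit_wt_def)
    have "\<bar>ht (refl_wt i c)\<bar> < \<bar>ht c\<bar>"
      using i roots_weightE(2,3)[OF less.prems(1), of k] roots_weightE(2,3)[OF less.prems(1), of i]
        roots_weightE(2,3)[OF root, of k] roots_weightE(4)[OF less.prems(1)] roots_weightE(4)[OF root]
        k(2) same ht_refl_wt[of i c] by linarith
    then have "wt (refl_wt i c) \<in> real_roots \<gg>"
      using less.hyps[OF _ root] less.prems(2) by (simp add: form_refl_wt)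
    then show ?thesis by (rule real_roots_if_refl_wt[OF less.prems(1)])
  qed
qed

end

section \<open>Subalgebras generated by real root spaces\<close>

lemma root_space_subset_generated: "\<alpha> \<in> S \<Longrightarrow> root_space \<gg> \<alpha> \<subseteq> generated_subalgebra \<gg> S"
  unfolding generated_subalgebra_def
  using hull_subset[of "\<Union>\<alpha>\<in>S. root_space \<gg> \<alpha>"] by blast

lemma generated_subset:
  assumes "lie_subalgebra (scl \<gg>) (brk \<gg>) L" "\<And>\<alpha>. \<alpha> \<in> S \<Longrightarrow> root_space \<gg> \<alpha> \<subseteq> L"
  shows "generated_subalgebra \<gg> S \<subseteq> L"
  unfolding generated_subalgebra_def by (rule hull_minimal) (use assms in auto)

context affine_kac_moody
begin

abbreviation real_wt :: "('n \<Rightarrow> int) \<Rightarrow> bool" where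
  "real_wt a \<equiv> wt a \<in> real_roots \<gg>"

lemma real_rootsE:
  assumes "\<alpha> \<in> real_roots \<gg>"
  obtains a where "\<alpha> = wt a" "real_wt a"
proof -
  have "\<alpha> \<in> roots \<gg>" using assms unfolding real_roots_def by blast
  then obtain a where "\<alpha> = wt a" by (rule rootsE)
  then show thesis using that assms by blast
qed

lemma real_wt_norm: "real_wt a \<Longrightarrow> form a a > 0"
  by (metis real_root_triple root_triple_nonzero(1))

lemma real_wt_roots: "real_wt a \<Longrightarrow> wt a \<in> roots \<gg>"
  unfolding real_roots_def by blast

lemma real_wt_uminus:
  assumes "real_wt a"
  shows "real_wt (- a)"
proof -
  obtain x y h where t: "root_triple a x y h" using assms by (rule real_root_triple)
  have "y = sc 1 y" by simp
  then have "y \<in> \<R> (wt (- a))" using t unfolding root_triple_def by blast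
  then have "wt (- a) \<in> roots \<gg>"
    unfolding weight_in_roots_iff using root_triple_nonzero[OF t] by auto
  then show ?thesis
    by (rule real_root_if_positive_norm) (simp add: form_uminus real_wt_norm[OF assms])
qed

text \<open>A relation instead of a function, because the coordinates of the reflection of \<open>b\<close> in
  \<open>a\<close> are known to be integers only after the reflection has been recognized as a root.\<close>

definition is_reflection :: "('n \<Rightarrow> int) \<Rightarrow> ('n \<Rightarrow> int) \<Rightarrow> ('n \<Rightarrow> int) \<Rightarrow> bool" where
  "is_reflection a b c \<longleftrightarrow>
     (\<forall>i. real_of_int (c i) = of_int (b i) - (2 * form b a / form a a) * of_int (a i))"

lemma weight_is_reflection:
  assumes "is_reflection a b c"
  shows "wt c k = wt b k - of_real (2 * form b a / form a a) * wt a k"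
proof -
  define m where "m = complex_of_real (2 * form b a / form a a)"
  have ci: "complex_of_int (c i) = of_int (b i) - m * of_int (a i)" for i
    using assms unfolding m_def unfolding is_reflection_def
    by (metis of_real_diff of_real_mult of_real_of_int_eq)
  have "wt c k = wt b k - m * wt a k"
    unfolding weight_def ci left_diff_distrib sum_subtractf sum_distrib_left mult.assoc ..
  then show ?thesis by (simp only: m_def)
qed

lemma is_reflection_uminus: "is_reflection a b c \<Longrightarrow> is_reflection a (- b) (- c)"
  unfolding is_reflection_def by (simp add: form_uminus)

text \<open>The automorphism of a triple for \<open>a\<close> produces a nonzero vector whose weight is the reflected
  functional. So this functional is a root, and its norm is that of \<open>b\<close>.\<close>

lemma real_wt_reflection:
  assumes "real_wt a" "real_wt b"
  obtains c where "is_reflection a b c" "real_wt c"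
proof -
  define m where "m = 2 * form b a / form a a"
  obtain x y h where t: "root_triple a x y h" using assms(1) by (rule real_root_triple)
  have sl2: "sl2_triple x y h" and h: "h \<in> cartan \<gg>" and wh: "\<And>c. wt c h = of_real (2 * form c a / form a a)"
    using t unfolding root_triple_def by auto
  have "sc 1 x \<in> \<R> (wt a)" "sc 1 y \<in> \<R> (wt (- a))" using t unfolding root_triple_def by blast+
  then have xy: "x \<in> \<R> (wt a)" "y \<in> \<R> (- wt a)" by (simp_all add: weight_uminus)
  have norm: "form a a > 0" by (rule real_wt_norm[OF assms(1)])
  then have two: "wt a h = 2" by (simp add: wh)
  obtain z where z: "z \<in> \<R> (wt b)" "z \<noteq> 0" and "b \<noteq> 0"
    using real_wt_roots[OF assms(2)] unfolding weight_in_roots_iff by blast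
  define \<gamma> where "\<gamma> = (\<lambda>k. wt b k - of_real m * wt a k)"
  have bh: "wt b h = of_real m" by (simp only: wh m_def)
  have dual: "\<gamma> \<in> dual_cartan \<gg>"
    using weight_in_dual[of a] weight_in_dual[of b]
    unfolding dual_cartan_def \<gamma>_def by (auto simp: algebra_simps)
  have "sl2_reflection x y z \<in> \<R> \<gamma>"
    using sl2_reflection_root_space[OF sl2 xy h two weight_in_dual weight_in_dual[of b]] z(1)
    by (simp add: \<gamma>_def bh)
  moreover have "sl2_reflection x y z \<noteq> 0"
    using lie_automorphism_eq_zero_iff[OF lie_automorphism_sl2_reflection[OF sl2]] z(2) by simp
  moreover have "\<gamma> \<noteq> 0"
  proof
    assume 0: "\<gamma> = 0"
    then have "wt b h - of_real m * wt a h = 0" by (metis \<gamma>_def zero_fun_apply)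
    then have "m = 0" by (simp add: bh two)
    then have "wt b = 0" using 0 by (simp add: \<gamma>_def fun_eq_iff)
    then show False using \<open>b \<noteq> 0\<close> by (simp add: weight_eq_0_iff)
  qed
  ultimately have root: "\<gamma> \<in> roots \<gg>" using dual unfolding roots_def by blast
  then obtain c where c: "\<gamma> = wt c" by (rule rootsE)
  have "(\<Sum>i\<in>UNIV. (of_int (c i) - of_int (b i) + of_real m * of_int (a i)) * simple_root \<gg> i k) = 0" for k
  proof -
    have "wt c k - wt b k + of_real m * wt a k = 0" unfolding c[symmetric] \<gamma>_def by simp
    then show ?thesis
      by (simp add: weight_def sum_subtractf sum.distrib sum_distrib_left algebra_simps)
  qed
  then have "of_int (c i) - of_int (b i) + of_real m * of_int (a i) = (0::complex)" for i
    by (rule roots_independent[of "\<lambda>i. of_int (c i) - of_int (b i) + of_real m * of_int (a i)"])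
  then have "complex_of_real (of_int (c i) - of_int (b i) + m * of_int (a i)) = 0" for i by simp
  then have ci: "real_of_int (c i) = of_int (b i) - m * of_int (a i)" for i
    by (simp only: of_real_eq_0_iff) (simp add: algebra_simps)
  then have comb: "form c d = form b d - m * form a d" "form d c = form d b - m * form d a" for d
    using form_combination[of c 1 b "- m" a d] by simp_all
  have "m * form a a = 2 * form b a" using norm by (simp add: m_def)
  then have "form c c = form b b"
    unfolding comb(1)[of c] comb(2)[of b] comb(2)[of a] by (simp add: form_sym[of a b] algebra_simps)
  then have "real_wt c"
    using real_root_if_positive_norm[of c] root c real_wt_norm[OF assms(2)] by simp
  moreover have "is_reflection a b c" using ci by (simp add: is_reflection_def m_def)
  ultimately show thesis using that by blast
qed

text \<open>The root spaces are lines, so it suffices that \<open>br x x1\<close> does not vanish. Let \<open>m\<close> be the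
  weight of \<open>x1\<close>. If \<open>m < 0\<close>, raising does not kill \<open>x1\<close>. Otherwise \<open>x2\<close> has the
  positive weight \<open>m + 2\<close>; lowering it gives a multiple of \<open>x1\<close>, and raising that multiple
  does not give zero.\<close>

lemma real_root_spaces_bracket:
  assumes L: "lie_subalgebra sc br L" and real: "real_wt a" "real_wt b" "real_wt (a + b)"
    and sub: "\<R> (wt a) \<subseteq> L" "\<R> (wt b) \<subseteq> L"
  shows "\<R> (wt (a + b)) \<subseteq> L"
proof -
  obtain x y h where t: "root_triple a x y h" using real(1) by (rule real_root_triple)
  obtain x1 y1 h1 where t1: "root_triple b x1 y1 h1" using real(2) by (rule real_root_triple)
  obtain x2 y2 h2 where t2: "root_triple (a + b) x2 y2 h2" using real(3) by (rule real_root_triple)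
  have sl2: "sl2_triple x y h" and h: "h \<in> cartan \<gg>" using t unfolding root_triple_def by auto
  have "sc 1 x \<in> \<R> (wt a)" "sc 1 y \<in> \<R> (wt (- a))" "sc 1 x1 \<in> \<R> (wt b)" "sc 1 x2 \<in> \<R> (wt (a + b))"
    using t t1 t2 unfolding root_triple_def by blast+
  then have x: "x \<in> \<R> (wt a)" and y: "y \<in> \<R> (wt (- a))" and x1: "x1 \<in> \<R> (wt b)"
    and x2: "x2 \<in> \<R> (wt (a + b))" by simp_all
  define m where "m = 2 * form b a / form a a"
  have wb: "wt b h = of_real m" using t unfolding root_triple_def m_def by blast
  have "wt a h = of_real (2 * form a a / form a a)" using t unfolding root_triple_def by blast
  then have wa: "wt a h = 2" using root_triple_nonzero(1)[OF t] by simp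
  have "br x x1 \<noteq> 0"
  proof (cases "m < 0")
    case True
    have "br (- h) x1 = sc (of_real (- m)) x1"
      using root_spaceD[OF x1 h] by (simp add: br_linear wb)
    then have "br y (br x x1) \<noteq> 0"
      by (rule br_raise_lower_nonzero[OF sl2_triple_swap[OF sl2]])
        (use True root_triple_nonzero(2)[OF t1] in simp_all)
    then show ?thesis by (auto simp: br_linear)
  next
    case False
    have "br h x2 = sc (of_real (m + 2)) x2"
      using root_spaceD[OF x2 h] by (simp add: wb wa weight_add add.commute)
    then have "br x (br y x2) \<noteq> 0"
      by (rule br_raise_lower_nonzero[OF sl2])
        (use False root_triple_nonzero(2)[OF t2] in simp_all)
    moreover have "br y x2 \<in> \<R> (wt b)"
      using br_root_space[OF y x2] by (simp flip: weight_add)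
    then obtain c where "br y x2 = sc c x1" using t1 unfolding root_triple_def by blast
    ultimately show ?thesis by (auto simp: br_linear)
  qed
  moreover have "br x x1 \<in> \<R> (wt (a + b))" using br_root_space[OF x x1] by (simp add: weight_add)
  then obtain c where c: "br x x1 = sc c x2" using t2 unfolding root_triple_def by blast
  ultimately have "c \<noteq> 0" by auto
  then have x2_eq: "x2 = sc (1 / c) (br x x1)" by (simp add: c)
  have "br x x1 \<in> L" using L sub x x1 unfolding lie_subalgebra_def by blast
  then have "sc d x2 \<in> L" for d
    unfolding x2_eq using L unfolding lie_subalgebra_def by (blast intro: subspace_scale)
  then show ?thesis using t2 unfolding root_triple_def by auto
qed

text \<open>A subalgebra that contains both outer elements of the triple of \<open>a\<close> is stable under the
  reflection automorphism of the triple.\<close>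

lemma real_root_spaces_reflection:
  assumes L: "lie_subalgebra sc br L" and a: "real_wt a" "\<R> (wt a) \<subseteq> L" "\<R> (wt (- a)) \<subseteq> L"
    and b: "\<R> (wt b) \<subseteq> L" and c: "is_reflection a b c"
  shows "\<R> (wt c) \<subseteq> L"
proof
  fix w assume w: "w \<in> \<R> (wt c)"
  obtain x y h where t: "root_triple a x y h" using a(1) by (rule real_root_triple)
  have sl2: "sl2_triple x y h" and h: "h \<in> cartan \<gg>" and wh: "\<And>c. wt c h = of_real (2 * form c a / form a a)"
    using t unfolding root_triple_def by auto
  have "sc 1 x \<in> \<R> (wt a)" "sc 1 y \<in> \<R> (wt (- a))" using t unfolding root_triple_def by blast+
  then have xy: "x \<in> \<R> (wt a)" "y \<in> \<R> (- wt a)" and xyL: "x \<in> L" "y \<in> L"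
    using a by (auto simp: weight_uminus)
  have two: "wt a h = 2" using real_wt_norm[OF a(1)] by (simp add: wh)
  obtain v where v: "w = sl2_reflection x y v"
    using lie_automorphism_sl2_reflection[OF sl2] unfolding lie_automorphism_def by (metis bij_pointE)
  have "wt c = (\<lambda>k. wt b k - wt b h * wt a k)"
    using weight_is_reflection[OF c] wh[of b] by (simp add: fun_eq_iff)
  then have "v \<in> \<R> (wt b)"
    using sl2_reflection_root_space[OF sl2 xy h two weight_in_dual weight_in_dual[of b], of v] w v by simp
  then show "w \<in> L"
    unfolding v using lie_subalgebra_sl2_reflection[OF L xyL] b by blast
qed

text \<open>Both signs are recorded: a subalgebra that contains the root space of \<open>a\<close> need not contain
  the one of \<open>- a\<close>, but the reflection automorphism requires both.\<close>

definition contains_root_pair :: "'g set \<Rightarrow> ('n \<Rightarrow> int) \<Rightarrow> bool" where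
  "contains_root_pair L a \<longleftrightarrow> \<R> (wt a) \<subseteq> L \<and> \<R> (wt (- a)) \<subseteq> L"

lemma contains_root_pair_uminus: "contains_root_pair L (- a) \<longleftrightarrow> contains_root_pair L a"
  unfolding contains_root_pair_def by auto

lemma contains_root_pair_add:
  assumes "lie_subalgebra sc br L" "real_wt a" "real_wt b" "real_wt (a + b)"
    and "contains_root_pair L a" "contains_root_pair L b"
  shows "contains_root_pair L (a + b)"
  using real_root_spaces_bracket[OF assms(1-4)] real_wt_uminus[OF assms(4)]
    real_root_spaces_bracket[OF assms(1) real_wt_uminus[OF assms(2)] real_wt_uminus[OF assms(3)]]
    assms(5,6)
  unfolding contains_root_pair_def by (simp add: add.commute)

lemma contains_root_pair_reflection:
  assumes "lie_subalgebra sc br L" "real_wt a" "is_reflection a b c"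
    and "contains_root_pair L a" "contains_root_pair L b"
  shows "contains_root_pair L c"
  using assms real_root_spaces_reflection[OF assms(1,2) _ _ _ assms(3)]
    real_root_spaces_reflection[OF assms(1,2) _ _ _ is_reflection_uminus[OF assms(3)]]
  unfolding contains_root_pair_def by blast

text \<open>The coordinates of a closed subroot system, with its symmetry made explicit.\<close>

definition closed_weights :: "('n \<Rightarrow> int) set \<Rightarrow> bool" where
  "closed_weights P \<longleftrightarrow> P \<noteq> {} \<and> (\<forall>a\<in>P. real_wt a \<and> - a \<in> P) \<and>
     (\<forall>a\<in>P. \<forall>b\<in>P. \<forall>c. is_reflection a b c \<longrightarrow> c \<in> P) \<and>
     (\<forall>a\<in>P. \<forall>b\<in>P. real_wt (a + b) \<longrightarrow> a + b \<in> P)"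

lemma closed_weightsD:
  assumes "closed_weights P"
  shows "P \<noteq> {}" "a \<in> P \<Longrightarrow> real_wt a" "a \<in> P \<Longrightarrow> - a \<in> P"
    "a \<in> P \<Longrightarrow> b \<in> P \<Longrightarrow> is_reflection a b c \<Longrightarrow> c \<in> P"
    "a \<in> P \<Longrightarrow> b \<in> P \<Longrightarrow> real_wt (a + b) \<Longrightarrow> a + b \<in> P"
proof -
  note c = assms[unfolded closed_weights_def]
  show "P \<noteq> {}" by (rule c[THEN conjunct1])
  note c1 = c[THEN conjunct2, THEN conjunct1]
  show "a \<in> P \<Longrightarrow> real_wt a" "a \<in> P \<Longrightarrow> - a \<in> P"
    by (drule bspec[OF c1]; erule conjE; assumption)+
  note c2 = c[THEN conjunct2, THEN conjunct2, THEN conjunct1]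
    and c3 = c[THEN conjunct2, THEN conjunct2, THEN conjunct2]
  show "a \<in> P \<Longrightarrow> b \<in> P \<Longrightarrow> is_reflection a b c \<Longrightarrow> c \<in> P"
    by (rule mp[OF spec[OF bspec[OF bspec[OF c2]]]])
  show "a \<in> P \<Longrightarrow> b \<in> P \<Longrightarrow> real_wt (a + b) \<Longrightarrow> a + b \<in> P"
    by (rule mp[OF bspec[OF bspec[OF c3]]])
qed

definition lower_subalgebra :: "('n \<Rightarrow> int) set \<Rightarrow> ('n \<Rightarrow> int) \<Rightarrow> 'g set" where
  "lower_subalgebra P a = generated_subalgebra \<gg> (wt ` {b \<in> P. \<bar>ht b\<bar> < \<bar>ht a\<bar>})"

text \<open>A root enters the base if the roots closer to zero do not generate its root spaces. With
  this choice the base generates by induction on the height, and a root is excluded from it as soon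
  as suitable lower roots are exhibited. Indecomposability with respect to sums of two roots would
  not do: it does not exclude two roots that differ by an imaginary root.\<close>

definition base :: "('n \<Rightarrow> int) set \<Rightarrow> ('n \<Rightarrow> int) set" where
  "base P = {a \<in> P. ht a > 0 \<and> \<not> contains_root_pair (lower_subalgebra P a) a}"

lemma lie_subalgebra_generated: "lie_subalgebra sc br (generated_subalgebra \<gg> S)"
  unfolding generated_subalgebra_def by (rule lie_subalgebra_hull)

lemma contains_root_pair_generated:
  "a \<in> X \<Longrightarrow> - a \<in> X \<Longrightarrow> contains_root_pair (generated_subalgebra \<gg> (wt ` X)) a"
  unfolding contains_root_pair_def by (auto intro!: root_space_subset_generated)

lemma lower_subalgebra_contains:
  assumes "closed_weights P" "b \<in> P" "\<bar>ht b\<bar> < \<bar>ht a\<bar>"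
  shows "contains_root_pair (lower_subalgebra P a) b"
  unfolding lower_subalgebra_def
  by (rule contains_root_pair_generated) (use assms closed_weightsD(3)[OF assms(1)] in \<open>simp_all add: ht_linear\<close>)

text \<open>If \<open>a - b\<close> is real, then \<open>a\<close> is the sum of the two roots \<open>b\<close> and \<open>a - b\<close>. If it is
  isotropic, it is orthogonal to everything, so \<open>a\<close> is the reflection in \<open>b\<close> of
  \<open>a - 2 b\<close>. In both cases these roots are closer to zero than \<open>a\<close>.\<close>

lemma generated_by_lower:
  assumes P: "closed_weights P" and ab: "a \<in> P" "b \<in> P" and ht: "0 < ht b" "ht b < ht a"
    and diff: "real_wt (a - b) \<or> form (a - b) (a - b) = 0"
  shows "contains_root_pair (lower_subalgebra P a) a"
proof -
  let ?L = "lower_subalgebra P a"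
  have L: "lie_subalgebra sc br ?L" unfolding lower_subalgebra_def by (rule lie_subalgebra_generated)
  have real: "real_wt a" "real_wt b" by (intro closed_weightsD(2)[OF P] ab)+
  have b: "contains_root_pair ?L b" using ht by (intro lower_subalgebra_contains P ab) auto
  from diff show ?thesis
  proof
    assume d: "real_wt (a - b)"
    have "a - b \<in> P"
      using closed_weightsD(5)[OF P ab(1) closed_weightsD(3)[OF P ab(2)]] d by simp
    then have "contains_root_pair ?L (a - b)"
      using ht by (intro lower_subalgebra_contains P) (auto simp: ht_linear)
    then have "contains_root_pair ?L (b + (a - b))"
      using real by (intro contains_root_pair_add L b d) (auto simp: real)
    then show ?thesis by simp
  next
    assume "form (a - b) (a - b) = 0"
    then have "form a b = form b b" using form_isotropic[of "a - b" b] by (simp add: form_diff)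
    moreover have norm: "form b b > 0" by (rule real_wt_norm[OF real(2)])
    ultimately have two: "2 * form a b / form b b = 2" by simp
    define d where "d = (\<lambda>i. a i - 2 * b i)"
    have "is_reflection b a d" unfolding is_reflection_def two by (simp add: d_def)
    then have "d \<in> P" by (rule closed_weightsD(4)[OF P ab(2,1)])
    moreover have "ht d = ht a - 2 * ht b" by (simp add: ht_def d_def sum_subtractf sum_distrib_left)
    ultimately have d: "contains_root_pair ?L d" using ht by (intro lower_subalgebra_contains P) auto
    have "form d b = - form b b"
      using form_combination(1)[of d 1 a "-2" b b] \<open>form a b = form b b\<close> by (simp add: d_def)
    then have "2 * form d b / form b b = - 2" using norm by simp
    then have "is_reflection b d a" unfolding is_reflection_def by (simp add: d_def)
    then show ?thesis by (rule contains_root_pair_reflection[OF L real(2) _ b d])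
  qed
qed

lemma base_subset: "base P \<subseteq> P"
  unfolding base_def by blast

lemma base_generates:
  assumes P: "closed_weights P"
  shows "generated_subalgebra \<gg> (wt ` (base P \<union> uminus ` base P)) = generated_subalgebra \<gg> (wt ` P)"
proof (rule equalityI)
  let ?M = "generated_subalgebra \<gg> (wt ` (base P \<union> uminus ` base P))"
  have sub: "base P \<union> uminus ` base P \<subseteq> P"
    using closed_weightsD(3)[OF P] base_subset[of P] by auto
  show "?M \<subseteq> generated_subalgebra \<gg> (wt ` P)"
    by (intro generated_subset lie_subalgebra_generated root_space_subset_generated) (use sub in auto)
  have "contains_root_pair ?M a" if "a \<in> P" for a
    using that
  proof (induction "nat \<bar>ht a\<bar>" arbitrary: a rule: less_induct)
    case less
    have IH: "contains_root_pair ?M b" if "b \<in> P" "\<bar>ht b\<bar> < \<bar>ht a\<bar>" for b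
      using less.hyps[OF _ that(1)] that(2) by simp
    have lower: "lower_subalgebra P a \<subseteq> ?M"
      unfolding lower_subalgebra_def
      by (intro generated_subset lie_subalgebra_generated) (use IH in \<open>auto simp: contains_root_pair_def\<close>)
    have pos: "contains_root_pair ?M c" if "c \<in> P" "ht c > 0" "\<bar>ht c\<bar> = \<bar>ht a\<bar>" for c
    proof (cases "c \<in> base P")
      case True
      then show ?thesis by (intro contains_root_pair_generated) auto
    next
      case False
      then have "contains_root_pair (lower_subalgebra P c) c" using that unfolding base_def by blast
      moreover have "lower_subalgebra P c = lower_subalgebra P a"
        unfolding lower_subalgebra_def using that by simp
      ultimately show ?thesis using lower unfolding contains_root_pair_def by auto
    qed
    have "wt a \<in> roots \<gg>" by (rule real_wt_roots[OF closed_weightsD(2)[OF P less.prems]])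
    then have "ht a \<noteq> 0" by (rule roots_weightE(4))
    moreover have "- a \<in> P" by (rule closed_weightsD(3)[OF P less.prems])
    ultimately show ?case
      using pos[of a] pos[of "- a"] less.prems by (cases "ht a > 0") (auto simp: ht_linear contains_root_pair_uminus)
  qed
  then show "generated_subalgebra \<gg> (wt ` P) \<subseteq> ?M"
    by (intro generated_subset lie_subalgebra_generated) (auto simp: contains_root_pair_def)
qed

text \<open>An empty base would generate only zero.\<close>

lemma base_nonempty:
  assumes P: "closed_weights P"
  shows "base P \<noteq> {}"
proof
  assume "base P = {}"
  then have "generated_subalgebra \<gg> (wt ` P) = generated_subalgebra \<gg> {}"
    using base_generates[OF P] by simp
  also have "\<dots> \<subseteq> {0}"
    by (rule generated_subset) (auto simp: lie_subalgebra_def br_linear subspace_single_0)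
  finally have sub: "generated_subalgebra \<gg> (wt ` P) \<subseteq> {0}" .
  obtain a where a: "a \<in> P" using closed_weightsD(1)[OF P] by blast
  then have "wt a \<in> roots \<gg>" by (intro real_wt_roots closed_weightsD(2)[OF P])
  then obtain x where "x \<in> \<R> (wt a)" "x \<noteq> 0" unfolding weight_in_roots_iff by blast
  then show False using sub root_space_subset_generated[of "wt a" "wt ` P"] a by blast
qed

text \<open>By the Cauchy-Schwarz inequality the integral values of the real roots on a simple coroot
  are bounded. Roots with the same values differ by an isotropic vector, so those of them that belong
  to the base have the same height, which leaves finitely many.\<close>

lemma base_finite:
  assumes P: "closed_weights P"
  shows "finite (base P)"
proof -
  \<comment> \<open>\<open>T\<close> sorts the roots into classes, each contained in a coset of the radical of the form;
      \<open>B\<close> bounds all real norms and \<open>K i\<close> the \<open>i\<close>-th entry of \<open>T\<close>\<close>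
  define T where "T a = (\<lambda>i. pair i a)" for a
  define B where "B = (\<Sum>j\<in>UNIV. 2 / eps j)"
  define K where "K i = \<lceil>2 * eps i * B\<rceil>" for i
  have real: "real_wt a" if "a \<in> base P" for a
    using that base_subset closed_weightsD(2)[OF P] by blast
  have bound: "\<bar>pair i a\<bar> \<le> K i" if a: "a \<in> base P" for a i
  proof -
    obtain x y h where "root_triple a x y h" using real[OF a] by (rule real_root_triple)
    then obtain j where "form a a = 2 / eps j" unfolding root_triple_def by blast
    moreover have "2 / eps j \<le> B"
      unfolding B_def by (rule member_le_sum) (use eps_pos in \<open>auto simp: less_imp_le\<close>)
    ultimately have aB: "form a a \<le> B" by simp
    have "(form (unit_wt i) a)\<^sup>2 \<le> form (unit_wt i) (unit_wt i) * form a a"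
      unfolding form_def by (rule rform_Cauchy_Schwarz)
    also have "\<dots> \<le> 2 / eps i * B"
      unfolding form_unit_wt_self using eps_pos[of i] by (intro mult_left_mono aB) simp
    finally have "(real_of_int (pair i a))\<^sup>2 / (eps i)\<^sup>2 \<le> 2 / eps i * B"
      by (simp add: form_unit_wt power_divide)
    then have "(real_of_int (pair i a))\<^sup>2 \<le> 2 * eps i * B"
      using eps_pos[of i] by (simp add: field_simps power2_eq_square)
    moreover have "\<bar>pair i a\<bar> * 1 \<le> \<bar>pair i a\<bar> * \<bar>pair i a\<bar>"
      by (cases "pair i a = 0", simp, intro mult_left_mono) auto
    then have "\<bar>pair i a\<bar> \<le> (pair i a)\<^sup>2" by (simp add: power2_eq_square)
    then have "real_of_int \<bar>pair i a\<bar> \<le> (real_of_int (pair i a))\<^sup>2"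
      by (metis of_int_le_iff of_int_power)
    ultimately have "real_of_int \<bar>pair i a\<bar> \<le> 2 * eps i * B" by linarith
    then show ?thesis unfolding K_def by linarith
  qed
  have "- K i \<le> pair i a \<and> pair i a \<le> K i" if "a \<in> base P" for a i
    using bound[OF that, of i] by linarith
  then have "T ` base P \<subseteq> PiE UNIV (\<lambda>i. {- K i..K i})"
    by (auto simp: T_def)
  then have fin: "finite (T ` base P)"
    by (rule finite_subset) (simp add: finite_PiE)
  have "finite {a \<in> base P. T a = t}" for t
  proof (cases "{a \<in> base P. T a = t} = {}")
    case False
    then obtain b where b: "b \<in> base P" "T b = t" by blast
    have same: "ht a = ht b" if a: "a \<in> base P" "T a = t" for a
    proof -
      have orth: "form d (a - b) = 0" for d
      proof -
        have "pair i (a - b) = pair i a - pair i b" for i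
          by (simp add: pair_def sum_subtractf algebra_simps)
        moreover have "pair i a = pair i b" for i using a b unfolding T_def by metis
        ultimately show ?thesis by (simp add: form_eq_sum_pair)
      qed
      have iso: "form (a - b) (a - b) = 0" by (rule orth)
      have iso': "form (b - a) (b - a) = 0"
        using orth[of "b - a"] unfolding form_diff(2)[of "b - a"] by simp
      have mem: "a \<in> P" "b \<in> P" and pos: "ht a > 0" "ht b > 0"
        using a b unfolding base_def by auto
      have "\<not> ht b < ht a"
        using generated_by_lower[OF P mem pos(2)] iso a(1) unfolding base_def by blast
      moreover have "\<not> ht a < ht b"
        using generated_by_lower[OF P mem(2,1) pos(1)] iso' b(1) unfolding base_def by blast
      ultimately show ?thesis by simp
    qed
    have "{a \<in> base P. T a = t} \<subseteq> PiE UNIV (\<lambda>_. {0..ht b})"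
    proof
      fix a assume "a \<in> {a \<in> base P. T a = t}"
      then have a: "a \<in> base P" "T a = t" by auto
      have "wt a \<in> roots \<gg>" by (rule real_wt_roots[OF real[OF a(1)]])
      moreover have "ht a > 0" using a(1) unfolding base_def by blast
      ultimately have nonneg: "a i \<ge> 0" for i by (rule roots_weightE(2))
      then have "a i \<le> ht a" for i unfolding ht_def by (intro member_le_sum) auto
      then show "a \<in> PiE UNIV (\<lambda>_. {0..ht b})" using nonneg same[OF a] by auto
    qed
    then show ?thesis by (rule finite_subset) (simp add: finite_PiE)
  qed (simp only: finite.emptyI)
  then have "finite (\<Union>t\<in>T ` base P. {a \<in> base P. T a = t})" using fin by blast
  moreover have "base P = (\<Union>t\<in>T ` base P. {a \<in> base P. T a = t})" by blast
  ultimately show ?thesis by simp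
qed

text \<open>A root that is a difference of two base elements is real or isotropic. In both cases the
  higher of the two elements would be generated by lower roots; their heights differ because no
  root has height zero.\<close>

lemma pi_system_base:
  assumes P: "closed_weights P"
  shows "pi_system \<gg> (wt ` base P)"
  unfolding pi_system_def
proof (intro conjI ballI)
  show "wt ` base P \<noteq> {}" using base_nonempty[OF P] by simp
  show "finite (wt ` base P)" using base_finite[OF P] by simp
  show "wt ` base P \<subseteq> real_roots \<gg>" using base_subset closed_weightsD(2)[OF P] by blast
  fix \<alpha> \<beta> assume "\<alpha> \<in> wt ` base P" "\<beta> \<in> wt ` base P"
  then obtain a b where ab: "a \<in> base P" "b \<in> base P" and \<alpha>\<beta>: "\<alpha> = wt a" "\<beta> = wt b" by blast
  have mem: "a \<in> P" "b \<in> P" and pos: "ht a > 0" "ht b > 0" using ab unfolding base_def by auto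
  show "\<alpha> - \<beta> \<notin> roots \<gg>"
  proof
    assume "\<alpha> - \<beta> \<in> roots \<gg>"
    then have root: "wt (a - b) \<in> roots \<gg>" by (simp add: \<alpha>\<beta> weight_diff)
    then have "ht a \<noteq> ht b" using roots_weightE(4) by (fastforce simp: ht_linear)
    have d1: "real_wt (a - b) \<or> form (a - b) (a - b) = 0"
      using real_root_if_positive_norm[OF root] form_nonneg[of "a - b"] by linarith
    then have d2: "real_wt (b - a) \<or> form (b - a) (b - a) = 0"
      using real_wt_uminus[of "a - b"] by (auto simp: form_diff form_sym[of b a])
    show False
    proof (cases "ht b < ht a")
      case True
      then show False using generated_by_lower[OF P mem pos(2) _ d1] ab(1) unfolding base_def by blast
    next
      case False
      then have "ht a < ht b" using \<open>ht a \<noteq> ht b\<close> by simp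
      then show False using generated_by_lower[OF P mem(2,1) pos(1) _ d2] ab(2) unfolding base_def by blast
    qed
  qed
qed

section \<open>The three descriptions\<close>

text \<open>On the span of the simple roots every standard form with parameters \<open>eps\<close> is the form
  \<open>form\<close>, because \<open>wt c\<close> corresponds to the combination of the coroots with coefficients
  \<open>c i / eps i\<close>.\<close>

lemma standard_form_weight:
  assumes add: "\<And>x y z. x \<in> cartan \<gg> \<Longrightarrow> y \<in> cartan \<gg> \<Longrightarrow> z \<in> cartan \<gg> \<Longrightarrow> B (x + y) z = B x z + B y z"
    and scale: "\<And>c x y. x \<in> cartan \<gg> \<Longrightarrow> y \<in> cartan \<gg> \<Longrightarrow> B (sc c x) y = c * B x y"
    and coroots: "\<And>i h. h \<in> cartan \<gg> \<Longrightarrow> B (coroot i) h = simple_root \<gg> i h * of_real (eps i)"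
    and F: "\<And>x y. x \<in> cartan \<gg> \<Longrightarrow> y \<in> cartan \<gg> \<Longrightarrow>
      F (\<lambda>h. if h \<in> cartan \<gg> then B x h else 0) (\<lambda>h. if h \<in> cartan \<gg> then B y h else 0) = B x y"
  shows "F (wt a) (wt b) = of_real (form a b)"
proof -
  define v where "v c = (\<Sum>i\<in>UNIV. sc (of_int (c i) / of_real (eps i)) (coroot i))" for c
  have sum_cartan: "(\<Sum>i\<in>I. sc (r i) (coroot i)) \<in> cartan \<gg>" for I r
    by (intro subspace_sum subspace_scale cartan_subspace coroot_in_cartan)
  have zero: "0 \<in> cartan \<gg>" by (rule subspace_0[OF cartan_subspace])
  have term_cartan: "sc r (coroot i) \<in> cartan \<gg>" for r i
    by (intro subspace_scale cartan_subspace coroot_in_cartan)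
  have v_cartan: "v c \<in> cartan \<gg>" for c unfolding v_def by (rule sum_cartan)
  have B_sum: "B (\<Sum>i\<in>I. sc (r i) (coroot i)) z = (\<Sum>i\<in>I. r i * B (coroot i) z)"
    if "finite I" "z \<in> cartan \<gg>" for I r z
    using that
  proof (induction I rule: finite_induct)
    case empty
    then show ?case using scale[OF zero, of z 0] by simp
  next
    case (insert i I)
    then show ?case
      using add[OF term_cartan sum_cartan, of z "r i" i r I] scale[OF coroot_in_cartan, of z "r i" i] by simp
  qed
  have Bv: "B (v c) h = wt c h" if "h \<in> cartan \<gg>" for c h
  proof -
    have "B (v c) h = (\<Sum>i\<in>UNIV. of_int (c i) / of_real (eps i) * (simple_root \<gg> i h * of_real (eps i)))"
      unfolding v_def by (subst B_sum) (simp_all add: that coroots)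
    also have "\<dots> = wt c h"
      unfolding weight_def
    proof (rule sum.cong[OF HOL.refl])
      fix i
      show "of_int (c i) / of_real (eps i) * (simple_root \<gg> i h * of_real (eps i)) = of_int (c i) * simple_root \<gg> i h"
        using eps_pos[of i] by simp
    qed
    finally show ?thesis .
  qed
  have ext: "(\<lambda>h. if h \<in> cartan \<gg> then B (v c) h else 0) = wt c" for c
    using Bv dual_cartanD(3)[OF weight_in_dual] by (auto simp: fun_eq_iff)
  have wt_sum: "wt a (\<Sum>i\<in>I. sc (r i) (coroot i)) = (\<Sum>i\<in>I. r i * wt a (coroot i))" if "finite I" for I r
    using that
  proof (induction I rule: finite_induct)
    case empty
    then show ?case using dual_cartanD(2)[OF weight_in_dual zero, of a 0] by simp
  next
    case (insert i I)
    then show ?case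
      using dual_cartanD(1)[OF weight_in_dual term_cartan sum_cartan, of a "r i" i r I]
        dual_cartanD(2)[OF weight_in_dual coroot_in_cartan, of a "r i" i] by simp
  qed
  have "F (wt a) (wt b) = B (v a) (v b)"
    using F[OF v_cartan[of a] v_cartan[of b]] unfolding ext .
  also have "\<dots> = wt a (v b)" by (rule Bv[OF v_cartan])
  also have "\<dots> = (\<Sum>i\<in>UNIV. of_int (b i) / of_real (eps i) * of_int (pair i a))"
    unfolding v_def by (subst wt_sum) (simp_all add: weight_coroot)
  also have "\<dots> = of_real (\<Sum>i\<in>UNIV. of_int (b i) * (pair i a / eps i))"
    by simp
  also have "(\<Sum>i\<in>UNIV. of_int (b i) * (pair i a / eps i)) = form a b"
    by (metis form_sym form_eq_sum_pair)
  finally show ?thesis .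
qed

lemma symmetric_subset_of_pi_system:
  assumes "pi_system \<gg> S"
  shows "symmetric_subset \<gg> (S \<union> uminus ` S)"
proof -
  have "- \<alpha> \<in> real_roots \<gg>" if "\<alpha> \<in> S" for \<alpha>
  proof -
    have "\<alpha> \<in> real_roots \<gg>" using that assms unfolding pi_system_def by (meson subsetD)
    then obtain a where "\<alpha> = wt a" "real_wt a" by (rule real_rootsE)
    then show ?thesis using real_wt_uminus[of a] by (simp add: weight_uminus)
  qed
  then have "uminus ` S \<subseteq> real_roots \<gg>" by (rule image_subsetI)
  moreover have "S \<noteq> {}" using assms unfolding pi_system_def by (elim conjE)
  moreover have "S \<subseteq> real_roots \<gg>" using assms unfolding pi_system_def by (elim conjE)
  moreover have "uminus ` (S \<union> uminus ` S) = S \<union> uminus ` S"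
    by (simp only: image_Un image_image minus_minus image_ident Un_commute)
  ultimately show ?thesis unfolding symmetric_subset_def by (intro conjI Un_least) simp_all
qed

context
  fixes F :: "('g \<Rightarrow> complex) \<Rightarrow> ('g \<Rightarrow> complex) \<Rightarrow> complex"
  assumes F: "\<And>a b. F (wt a) (wt b) = of_real (form a b)"
begin

lemma reflection_weight:
  "reflection F (wt a) (wt b) = (\<lambda>k. wt b k - of_real (2 * form b a / form a a) * wt a k)"
  by (simp add: reflection_def F)

lemma reflection_is_reflection:
  "is_reflection a b c \<Longrightarrow> reflection F (wt a) (wt b) = wt c"
  by (simp add: reflection_weight weight_is_reflection fun_eq_iff)

lemma reflection_self: "real_wt a \<Longrightarrow> reflection F (wt a) (wt a) = wt (- a)"
  by (rule reflection_is_reflection) (use real_wt_norm[of a] in \<open>simp add: is_reflection_def\<close>)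

lemma closed_subroot_system_weights:
  assumes "closed_subroot_system \<gg> F \<Psi>"
  obtains P where "\<Psi> = wt ` P" "closed_weights P"
proof
  have \<Psi>: "\<Psi> \<noteq> {}" "\<Psi> \<subseteq> real_roots \<gg>" "\<And>\<alpha> \<beta>. \<alpha> \<in> \<Psi> \<Longrightarrow> \<beta> \<in> \<Psi> \<Longrightarrow> reflection F \<alpha> \<beta> \<in> \<Psi>"
    "\<And>\<alpha> \<beta>. \<alpha> \<in> \<Psi> \<Longrightarrow> \<beta> \<in> \<Psi> \<Longrightarrow> \<alpha> + \<beta> \<in> real_roots \<gg> \<Longrightarrow> \<alpha> + \<beta> \<in> \<Psi>"
    using assms unfolding closed_subroot_system_def by auto
  show eq: "\<Psi> = wt ` {a. wt a \<in> \<Psi>}"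
  proof
    show "\<Psi> \<subseteq> wt ` {a. wt a \<in> \<Psi>}"
    proof
      fix \<alpha> assume "\<alpha> \<in> \<Psi>"
      moreover from this \<Psi>(2) obtain a where "\<alpha> = wt a" using real_rootsE by blast
      ultimately show "\<alpha> \<in> wt ` {a. wt a \<in> \<Psi>}" by blast
    qed
  qed blast
  show "closed_weights {a. wt a \<in> \<Psi>}"
    unfolding closed_weights_def
  proof (intro conjI ballI allI impI)
    show "{a. wt a \<in> \<Psi>} \<noteq> {}" using eq \<Psi>(1) by blast
    fix a assume a: "a \<in> {a. wt a \<in> \<Psi>}"
    then show real: "real_wt a" using \<Psi>(2) by blast
    show "- a \<in> {a. wt a \<in> \<Psi>}" using \<Psi>(3)[of "wt a" "wt a"] a reflection_self[OF real] by simp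
    fix b assume b: "b \<in> {a. wt a \<in> \<Psi>}"
    show "c \<in> {a. wt a \<in> \<Psi>}" if "is_reflection a b c" for c
      using \<Psi>(3)[of "wt a" "wt b"] a b reflection_is_reflection[OF that] by simp
    show "a + b \<in> {a. wt a \<in> \<Psi>}" if "real_wt (a + b)"
      using \<Psi>(4)[of "wt a" "wt b"] a b that by (simp add: weight_add)
  qed
qed

text \<open>The system consists of all real roots for which the generated algebra contains both root
  spaces.\<close>

lemma closed_subroot_system_of_symmetric:
  assumes S: "symmetric_subset \<gg> S"
  obtains \<Psi> where "closed_subroot_system \<gg> F \<Psi>"
    "generated_subalgebra \<gg> S = generated_subalgebra \<gg> \<Psi>"
proof
  let ?L = "generated_subalgebra \<gg> S"
  let ?\<Psi> = "wt ` {a. real_wt a \<and> contains_root_pair ?L a}"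
  have L: "lie_subalgebra sc br ?L" by (rule lie_subalgebra_generated)
  have sub: "S \<subseteq> ?\<Psi>"
  proof
    fix \<alpha> assume \<alpha>: "\<alpha> \<in> S"
    then have "\<alpha> \<in> real_roots \<gg>" using S unfolding symmetric_subset_def by (meson subsetD)
    then obtain a where a: "\<alpha> = wt a" "real_wt a" by (rule real_rootsE)
    have "uminus ` S = S" using S unfolding symmetric_subset_def by (elim conjE)
    then have "- \<alpha> \<in> S" using imageI[OF \<alpha>, of uminus] by simp
    then have "contains_root_pair ?L a"
      using \<alpha> unfolding contains_root_pair_def a(1)
      by (simp add: root_space_subset_generated weight_uminus)
    then show "\<alpha> \<in> ?\<Psi>" using a by blast
  qed
  show "closed_subroot_system \<gg> F ?\<Psi>"
    unfolding closed_subroot_system_def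
  proof (intro conjI ballI impI)
    have "S \<noteq> {}" using S by (simp add: symmetric_subset_def)
    then show "?\<Psi> \<noteq> {}" using sub by (metis subset_empty)
    show "?\<Psi> \<subseteq> real_roots \<gg>" by blast
    fix \<alpha> \<beta> assume "\<alpha> \<in> ?\<Psi>" "\<beta> \<in> ?\<Psi>"
    then obtain a b where ab: "\<alpha> = wt a" "\<beta> = wt b" "real_wt a" "real_wt b"
      "contains_root_pair ?L a" "contains_root_pair ?L b" by blast
    obtain c where c: "is_reflection a b c" "real_wt c" using ab(3,4) by (rule real_wt_reflection)
    have "contains_root_pair ?L c"
      by (rule contains_root_pair_reflection[OF L ab(3) c(1) ab(5,6)])
    then show "reflection F \<alpha> \<beta> \<in> ?\<Psi>"
      using c reflection_is_reflection[OF c(1)] ab(1,2) by auto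
    assume "\<alpha> + \<beta> \<in> real_roots \<gg>"
    then have "real_wt (a + b)" by (simp add: ab weight_add)
    moreover from this have "contains_root_pair ?L (a + b)"
      by (intro contains_root_pair_add L ab)
    ultimately have "wt (a + b) \<in> ?\<Psi>" by blast
    then show "\<alpha> + \<beta> \<in> ?\<Psi>" by (simp only: ab weight_add)
  qed
  show "?L = generated_subalgebra \<gg> ?\<Psi>"
  proof
    show "?L \<subseteq> generated_subalgebra \<gg> ?\<Psi>"
      by (intro generated_subset lie_subalgebra_generated root_space_subset_generated) (use sub in blast)
    show "generated_subalgebra \<gg> ?\<Psi> \<subseteq> ?L"
      by (intro generated_subset L) (auto simp: contains_root_pair_def)
  qed
qed

lemma pi_system_of_closed_subroot_system:
  assumes "closed_subroot_system \<gg> F \<Psi>"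
  obtains S where "pi_system \<gg> S" "generated_subalgebra \<gg> \<Psi> = generated_subalgebra \<gg> (S \<union> uminus ` S)"
proof -
  obtain P where P: "\<Psi> = wt ` P" "closed_weights P"
    using assms by (rule closed_subroot_system_weights)
  have "wt ` (base P \<union> uminus ` base P) = wt ` base P \<union> uminus ` wt ` base P"
    by (auto simp: weight_uminus image_Un image_image)
  then show thesis
    using that[OF pi_system_base[OF P(2)]] base_generates[OF P(2)] P(1) by simp
qed

end

end

theorem theorem12p3p1:
  fixes A :: "int ^ 'n ^ 'n"
    and \<gg> :: "('g::ab_group_add, 'n) kac_moody_data"
    and F :: "('g \<Rightarrow> complex) \<Rightarrow> ('g \<Rightarrow> complex) \<Rightarrow> complex"
    and L :: "'g set"
  assumes "affine_cartan_matrix A"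
    and "kac_moody_algebra A \<gg>"
    and "standard_form A \<gg> F"
    and "lie_subalgebra (scl \<gg>) (brk \<gg>) L"
  shows "((\<exists>\<Psi>. closed_subroot_system \<gg> F \<Psi> \<and> L = generated_subalgebra \<gg> \<Psi>) \<longleftrightarrow>
          (\<exists>S. pi_system \<gg> S \<and> L = generated_subalgebra \<gg> (S \<union> uminus ` S))) \<and>
         ((\<exists>S. pi_system \<gg> S \<and> L = generated_subalgebra \<gg> (S \<union> uminus ` S)) \<longleftrightarrow>
          (\<exists>S. symmetric_subset \<gg> S \<and> L = generated_subalgebra \<gg> S))"
proof -
  interpret kac_moody_algebra A \<gg> by (rule assms(2))
  obtain u :: "real ^ 'n" where u: "\<forall>i. u $ i > 0" "real_matrix A *v u = 0"
    using assms(1) unfolding affine_cartan_matrix_def by blast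
  obtain B where B: "standard_form_on_cartan A \<gg> B"
    and F: "\<forall>x\<in>cartan \<gg>. \<forall>y\<in>cartan \<gg>. F (\<lambda>h. if h \<in> cartan \<gg> then B x h else 0)
             (\<lambda>h. if h \<in> cartan \<gg> then B y h else 0) = B x y"
    using assms(3) unfolding standard_form_def by blast
  from B obtain eps where eps: "\<forall>i. eps i > 0"
    "\<forall>i j. real_of_int (A $ i $ j) / eps i = real_of_int (A $ j $ i) / eps j"
    "\<forall>i. \<forall>h\<in>cartan \<gg>. B (simple_coroot \<gg> i) h = simple_root \<gg> i h * of_real (eps i)"
    unfolding standard_form_on_cartan_def by auto
  interpret affine_kac_moody A \<gg> eps "\<lambda>i. u $ i"
  proof unfold_locales
    show "eps i > 0" for i using eps(1) by blast
    show "real_of_int (A $ i $ j) / eps i = real_of_int (A $ j $ i) / eps j" for i j using eps(2) by blast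
    show "u $ i > 0" for i using u(1) by blast
    have "(real_matrix A *v u) $ i = (\<Sum>j\<in>UNIV. real_of_int (A $ i $ j) * u $ j)" for i
      by (simp add: matrix_vector_mult_def real_matrix_def map_matrix_def)
    then show "(\<Sum>j\<in>UNIV. real_of_int (A $ i $ j) * u $ j) = 0" for i using u(2) by simp
  qed
  have F_form: "F (wt a) (wt b) = of_real (form a b)" for a b
    by (rule standard_form_weight[where B = B])
      (use B eps(3) F in \<open>auto simp: standard_form_on_cartan_def\<close>)
  show ?thesis
  proof (intro conjI iffI; elim exE conjE)
    fix \<Psi> assume "closed_subroot_system \<gg> F \<Psi>" "L = generated_subalgebra \<gg> \<Psi>"
    then show "\<exists>S. pi_system \<gg> S \<and> L = generated_subalgebra \<gg> (S \<union> uminus ` S)"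
      by (metis pi_system_of_closed_subroot_system[OF F_form])
  next
    fix S assume S: "pi_system \<gg> S" "L = generated_subalgebra \<gg> (S \<union> uminus ` S)"
    show "\<exists>S. symmetric_subset \<gg> S \<and> L = generated_subalgebra \<gg> S"
      using symmetric_subset_of_pi_system[OF S(1)] S(2) by (intro exI[of _ "S \<union> uminus ` S"] conjI)
    obtain \<Psi> where "closed_subroot_system \<gg> F \<Psi>" "L = generated_subalgebra \<gg> \<Psi>"
      using closed_subroot_system_of_symmetric[OF F_form symmetric_subset_of_pi_system[OF S(1)]] S(2)
      by metis
    then show "\<exists>\<Psi>. closed_subroot_system \<gg> F \<Psi> \<and> L = generated_subalgebra \<gg> \<Psi>" by (intro exI conjI)
  next
    fix S assume S: "symmetric_subset \<gg> S" "L = generated_subalgebra \<gg> S"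
    obtain \<Psi> where "closed_subroot_system \<gg> F \<Psi>" "L = generated_subalgebra \<gg> \<Psi>"
      using closed_subroot_system_of_symmetric[OF F_form S(1)] S(2) by metis
    then show "\<exists>S. pi_system \<gg> S \<and> L = generated_subalgebra \<gg> (S \<union> uminus ` S)"
      by (metis pi_system_of_closed_subroot_system[OF F_form])
  qed
qed

end
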